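(* Let $D$ be a principal ideal domain, and let $p$ be a prime number such that $pD$ is a prime ideal of $D$ and $D/pD$ is finite; write $\lambda=[D/pD:\mathbb{F}_p]$. Let $N$ be a commutative radical ring of order a power of $p$ such that $N$ is a $D$-module (compatibly with its ring structure, as specified in the context). If at least one of the abelian $p$-groups $N$ (the additive group) and $1+N$ (the adjoint group) is $\lambda$-small, then $N\cong 1+N$ as groups.
   Context: A radical ring is an associative ring $N$ (not assumed to have a unity) that equals its Jacobson radical; equivalently, $(N,\circ)$ with $x\circ y=x+y+xy$ is a group. The group $(N,\circ)$ is called the adjoint group of $N$ and is denoted $1+N=\{1+x\mid x\in N\}$ (formally, with $(1+x)(1+y)=1+(x+y+xy)$). When groups are compared, $N$ denotes the additive group of the ring. That $N$ is a $D$-module means that the additive group of $N$ is a $D$-module and the action is compatible with the multiplication: $d(xy)=(dx)y=x(dy)$ for all $d\in D$, $x,y\in N$. For a finite abelian $p$-group $M$, $\operatorname{P-rank} M$ (Prüfer rank) is the number of factors in a decomposition of $M$ into a direct sum of nontrivial cyclic $p$-groups. For a positive integer $\lambda$, $M$ is called $\lambda$-small if $\operatorname{P-rank} M<\lambda(p-1)$. *)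

theory Defs
  imports "HOL-Algebra.Algebra"
begin

section \<open>Rings without unity and the Jacobson radical\<close>

text \<open>The record type of HOL-Algebra rings (and modules) has a field \<open>one\<close>; nothing is assumed
  about its value here, so the record is used as a ring not assumed to have a unity.\<close>

locale nonunital_ring = abelian_group R for R (structure) +
  assumes nu_closed: "\<lbrakk> x \<in> carrier R; y \<in> carrier R \<rbrakk> \<Longrightarrow> x \<otimes> y \<in> carrier R"
    and nu_assoc: "\<lbrakk> x \<in> carrier R; y \<in> carrier R; z \<in> carrier R \<rbrakk>
      \<Longrightarrow> (x \<otimes> y) \<otimes> z = x \<otimes> (y \<otimes> z)"
    and nu_l_distr: "\<lbrakk> x \<in> carrier R; y \<in> carrier R; z \<in> carrier R \<rbrakk>
      \<Longrightarrow> (x \<oplus> y) \<otimes> z = x \<otimes> z \<oplus> y \<otimes> z"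
    and nu_r_distr: "\<lbrakk> x \<in> carrier R; y \<in> carrier R; z \<in> carrier R \<rbrakk>
      \<Longrightarrow> z \<otimes> (x \<oplus> y) = z \<otimes> x \<oplus> z \<otimes> y"

locale nonunital_cring = nonunital_ring +
  assumes nu_comm: "\<lbrakk> x \<in> carrier R; y \<in> carrier R \<rbrakk> \<Longrightarrow> x \<otimes> y = y \<otimes> x"

definition right_ideal :: "'a set \<Rightarrow> ('a, 'b) ring_scheme \<Rightarrow> bool" where
  "right_ideal I R \<longleftrightarrow>
     additive_subgroup I R \<and> (\<forall>a\<in>I. \<forall>x\<in>carrier R. a \<otimes>\<^bsub>R\<^esub> x \<in> I)"

definition maximal_right_ideal :: "'a set \<Rightarrow> ('a, 'b) ring_scheme \<Rightarrow> bool" where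
  "maximal_right_ideal I R \<longleftrightarrow> right_ideal I R \<and> I \<noteq> carrier R \<and>
     (\<forall>K. right_ideal K R \<longrightarrow> I \<subseteq> K \<longrightarrow> K = I \<or> K = carrier R)"

text \<open>Modular (regular) right ideals have a left identity modulo \<open>I\<close>; every right ideal is
  modular if the ring has a unity.\<close>

definition modular_right_ideal :: "'a set \<Rightarrow> ('a, 'b) ring_scheme \<Rightarrow> bool" where
  "modular_right_ideal I R \<longleftrightarrow>
     right_ideal I R \<and> (\<exists>e\<in>carrier R. \<forall>x\<in>carrier R. x \<ominus>\<^bsub>R\<^esub> e \<otimes>\<^bsub>R\<^esub> x \<in> I)"

definition jacobson_radical :: "('a, 'b) ring_scheme \<Rightarrow> 'a set" where
  "jacobson_radical R =
     {x \<in> carrier R. \<forall>I. modular_right_ideal I R \<and> maximal_right_ideal I R \<longrightarrow> x \<in> I}"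

definition radical_ring :: "('a, 'b) ring_scheme \<Rightarrow> bool" where
  "radical_ring R \<longleftrightarrow> nonunital_ring R \<and> jacobson_radical R = carrier R"

text \<open>The adjoint group \<open>1 + R\<close>; the formal element \<open>1 + x\<close> is represented by \<open>x\<close>.\<close>

definition adjoint_group :: "('a, 'b) ring_scheme \<Rightarrow> 'a monoid" where
  "adjoint_group R =
     \<lparr> carrier = carrier R, monoid.mult = (\<lambda>x y. x \<oplus>\<^bsub>R\<^esub> y \<oplus>\<^bsub>R\<^esub> x \<otimes>\<^bsub>R\<^esub> y), one = \<zero>\<^bsub>R\<^esub> \<rparr>"

context nonunital_ring
begin

lemma nu_l_null: "x \<in> carrier R \<Longrightarrow> \<zero> \<otimes> x = \<zero>"
  by (metis add.l_cancel_one' nu_closed nu_l_distr r_zero zero_closed)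

lemma nu_r_null: "x \<in> carrier R \<Longrightarrow> x \<otimes> \<zero> = \<zero>"
  by (metis add.l_cancel_one' nu_closed nu_r_distr r_zero zero_closed)

lemma nu_l_minus: "\<lbrakk> x \<in> carrier R; y \<in> carrier R \<rbrakk> \<Longrightarrow> (\<ominus> x) \<otimes> y = \<ominus> (x \<otimes> y)"
  by (metis a_inv_closed local.minus_equality l_neg nu_closed nu_l_distr nu_l_null)

lemma nu_r_minus: "\<lbrakk> x \<in> carrier R; y \<in> carrier R \<rbrakk> \<Longrightarrow> x \<otimes> (\<ominus> y) = \<ominus> (x \<otimes> y)"
  by (metis a_inv_closed local.minus_equality l_neg nu_closed nu_r_distr nu_r_null)

lemma monoid_adjoint: "monoid (adjoint_group R)"
  by (rule monoidI)
     (auto simp: adjoint_group_def nu_closed nu_l_null nu_r_null nu_l_distr nu_r_distr nu_assoc a_ac)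

lemma right_idealD:
  assumes "right_ideal I R"
  shows "I \<subseteq> carrier R" "\<zero> \<in> I" "\<And>a b. \<lbrakk> a \<in> I; b \<in> I \<rbrakk> \<Longrightarrow> a \<oplus> b \<in> I"
    "\<And>a. a \<in> I \<Longrightarrow> \<ominus> a \<in> I" "\<And>a x. \<lbrakk> a \<in> I; x \<in> carrier R \<rbrakk> \<Longrightarrow> a \<otimes> x \<in> I"
proof -
  have s: "subgroup I (add_monoid R)"
    using assms by (simp add: right_ideal_def additive_subgroup_def)
  show "I \<subseteq> carrier R" "\<zero> \<in> I" "\<And>a b. \<lbrakk> a \<in> I; b \<in> I \<rbrakk> \<Longrightarrow> a \<oplus> b \<in> I"
    using subgroup.subset[OF s] subgroup.one_closed[OF s] subgroup.m_closed[OF s] by auto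
  show "\<And>a. a \<in> I \<Longrightarrow> \<ominus> a \<in> I"
    using subgroup.m_inv_closed[OF s] by (simp add: a_inv_def)
  show "\<And>a x. \<lbrakk> a \<in> I; x \<in> carrier R \<rbrakk> \<Longrightarrow> a \<otimes> x \<in> I"
    using assms by (simp add: right_ideal_def)
qed

lemma right_idealI:
  assumes "I \<subseteq> carrier R" "\<zero> \<in> I" "\<And>a b. \<lbrakk> a \<in> I; b \<in> I \<rbrakk> \<Longrightarrow> a \<oplus> b \<in> I"
    "\<And>a. a \<in> I \<Longrightarrow> \<ominus> a \<in> I" "\<And>a x. \<lbrakk> a \<in> I; x \<in> carrier R \<rbrakk> \<Longrightarrow> a \<otimes> x \<in> I"
  shows "right_ideal I R"
  unfolding right_ideal_def additive_subgroup_def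
  using assms by (auto intro!: subgroup.intro simp flip: a_inv_def)

lemma modular_ideal_eq_carrier:
  assumes L: "right_ideal L R" and e: "e \<in> carrier R" "e \<in> L"
    and m: "\<And>y. y \<in> carrier R \<Longrightarrow> y \<ominus> e \<otimes> y \<in> L"
  shows "L = carrier R"
proof
  show "carrier R \<subseteq> L"
  proof
    fix y assume y: "y \<in> carrier R"
    have "(y \<ominus> e \<otimes> y) \<oplus> e \<otimes> y \<in> L"
      using right_idealD(3)[OF L m[OF y] right_idealD(5)[OF L e(2) y]] .
    then show "y \<in> L"
      using y e(1) nu_closed by (simp add: a_minus_def a_assoc l_neg)
  qed
qed (use right_idealD(1)[OF L] in auto)

lemma right_quasi_inverse:
  assumes J: "jacobson_radical R = carrier R" and x: "x \<in> carrier R"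
  shows "\<exists>y\<in>carrier R. x \<oplus> y \<oplus> x \<otimes> y = \<zero>"
proof -
  define e where "e = \<ominus> x"
  have e: "e \<in> carrier R" using x by (simp add: e_def)
  define I where "I = (\<lambda>y. y \<oplus> x \<otimes> y) ` carrier R"
  have I: "right_ideal I R"
  proof (rule right_idealI)
    show "I \<subseteq> carrier R" using x nu_closed by (auto simp: I_def)
    show "\<zero> \<in> I" using x nu_r_null by (auto simp: I_def intro!: image_eqI[of _ _ \<zero>])
    fix a assume "a \<in> I"
    then obtain y where y: "y \<in> carrier R" "a = y \<oplus> x \<otimes> y" by (auto simp: I_def)
    show "\<ominus> a \<in> I" unfolding I_def
      using x y nu_closed
      by (intro image_eqI[of _ _ "\<ominus> y"]) (auto simp: nu_r_minus minus_add a_comm)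
    show "a \<otimes> z \<in> I" if "z \<in> carrier R" for z unfolding I_def
      using x y nu_closed that
      by (intro image_eqI[of _ _ "y \<otimes> z"]) (auto simp: nu_l_distr nu_assoc)
    fix b assume "b \<in> I"
    then obtain z where z: "z \<in> carrier R" "b = z \<oplus> x \<otimes> z" by (auto simp: I_def)
    show "a \<oplus> b \<in> I" unfolding I_def
      using x y z nu_closed
      by (intro image_eqI[of _ _ "y \<oplus> z"]) (auto simp: nu_r_distr a_ac)
  qed
  have mod: "y \<ominus> e \<otimes> y \<in> I" if "y \<in> carrier R" for y
    using x that nu_closed by (auto simp: I_def e_def nu_l_minus a_minus_def)
  have "e \<in> I"
  proof (rule ccontr)
    assume eI: "e \<notin> I"
    define S where "S = {K. right_ideal K R \<and> I \<subseteq> K \<and> e \<notin> K}"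
    have "\<exists>M\<in>S. \<forall>T\<in>S. M \<subseteq> T \<longrightarrow> T = M"
    proof (rule subset_Zorn_nonempty)
      show "S \<noteq> {}" using I eI by (auto simp: S_def)
      fix C assume ne: "C \<noteq> {}" and ch: "subset.chain S C"
      have C: "right_ideal K R" "I \<subseteq> K" "e \<notin> K" if "K \<in> C" for K
        using ch that by (auto simp: S_def subset_chain_def)
      have "right_ideal (\<Union>C) R"
      proof (rule right_idealI)
        show "\<Union>C \<subseteq> carrier R" using C(1) right_idealD(1) by blast
        show "\<zero> \<in> \<Union>C" using ne C(1) right_idealD(2) by blast
        show "a \<oplus> b \<in> \<Union>C" if ab: "a \<in> \<Union>C" "b \<in> \<Union>C" for a b
        proof -
          obtain K L where KL: "K \<in> C" "L \<in> C" "a \<in> K" "b \<in> L" using ab by blast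
          then have "K \<subseteq> L \<or> L \<subseteq> K" using ch by (auto simp: subset_chain_def)
          then show ?thesis using KL C(1) right_idealD(3) by blast
        qed
        show "\<ominus> a \<in> \<Union>C" if "a \<in> \<Union>C" for a using that C(1) right_idealD(4) by blast
        show "a \<otimes> z \<in> \<Union>C" if "a \<in> \<Union>C" "z \<in> carrier R" for a z
          using that C(1) right_idealD(5) by blast
      qed
      then show "\<Union>C \<in> S" using ne C(2,3) by (auto simp: S_def)
    qed
    then obtain M where M: "M \<in> S" and max: "\<And>T. T \<in> S \<Longrightarrow> M \<subseteq> T \<Longrightarrow> T = M" by blast
    have rM: "right_ideal M R" and IM: "I \<subseteq> M" and eM: "e \<notin> M" using M by (auto simp: S_def)
    have "maximal_right_ideal M R"
      unfolding maximal_right_ideal_def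
    proof (intro conjI allI impI)
      show "M \<noteq> carrier R" using e eM by auto
      fix L assume L: "right_ideal L R" "M \<subseteq> L"
      show "L = M \<or> L = carrier R"
      proof (cases "e \<in> L")
        case True
        then show ?thesis using modular_ideal_eq_carrier[OF L(1) e True] mod IM L(2) by blast
      next
        case False
        then show ?thesis using max[of L] L IM by (auto simp: S_def)
      qed
    qed (rule rM)
    moreover have "modular_right_ideal M R"
      using rM e mod IM by (auto simp: modular_right_ideal_def)
    ultimately have "e \<in> M" using J e by (auto simp: jacobson_radical_def)
    with eM show False by blast
  qed
  then obtain y where y: "y \<in> carrier R" "e = y \<oplus> x \<otimes> y" by (auto simp: I_def)
  then have "x \<oplus> (y \<oplus> x \<otimes> y) = \<zero>" using x by (metis e_def r_neg)
  then show ?thesis using x y(1) nu_closed by (auto simp: a_assoc)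
qed

theorem jacobson_radical_eq_carrier_iff:
  "jacobson_radical R = carrier R \<longleftrightarrow> group (adjoint_group R)"
proof
  assume J: "jacobson_radical R = carrier R"
  interpret A: monoid "adjoint_group R" by (rule monoid_adjoint)
  have r: "\<exists>y\<in>carrier (adjoint_group R). x \<otimes>\<^bsub>adjoint_group R\<^esub> y = \<one>\<^bsub>adjoint_group R\<^esub>"
    if "x \<in> carrier (adjoint_group R)" for x
    using right_quasi_inverse[OF J] that by (simp add: adjoint_group_def)
  show "group (adjoint_group R)"
  proof (rule A.group_l_invI)
    fix x assume x: "x \<in> carrier (adjoint_group R)"
    obtain y where y: "y \<in> carrier (adjoint_group R)"
      "x \<otimes>\<^bsub>adjoint_group R\<^esub> y = \<one>\<^bsub>adjoint_group R\<^esub>" using r[OF x] by blast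
    obtain z where z: "z \<in> carrier (adjoint_group R)"
      "y \<otimes>\<^bsub>adjoint_group R\<^esub> z = \<one>\<^bsub>adjoint_group R\<^esub>" using r[OF y(1)] by blast
    have "x = z" using x y z by (metis A.m_assoc A.l_one A.r_one)
    then show "\<exists>y\<in>carrier (adjoint_group R). y \<otimes>\<^bsub>adjoint_group R\<^esub> x = \<one>\<^bsub>adjoint_group R\<^esub>"
      using y z by blast
  qed
next
  assume G: "group (adjoint_group R)"
  have False if I: "modular_right_ideal I R" "maximal_right_ideal I R" for I
  proof -
    from I(1) obtain e where e: "e \<in> carrier R" "\<And>x. x \<in> carrier R \<Longrightarrow> x \<ominus> e \<otimes> x \<in> I"
      and rI: "right_ideal I R" by (auto simp: modular_right_ideal_def)
    obtain y where y: "y \<in> carrier R" "\<ominus> e \<oplus> y \<oplus> (\<ominus> e) \<otimes> y = \<zero>"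
      using group.r_inv_ex[OF G, of "\<ominus> e"] e(1) by (auto simp: adjoint_group_def)
    then have "\<ominus> e \<oplus> (y \<ominus> e \<otimes> y) = \<zero>"
      using e(1) nu_closed by (simp add: nu_l_minus a_minus_def a_assoc)
    then have "e = y \<ominus> e \<otimes> y"
      using e(1) y(1) nu_closed by (metis a_inv_closed minus_closed minus_equality minus_minus a_comm)
    then have "e \<in> I" using e(2)[OF y(1)] by simp
    then show False
      using modular_ideal_eq_carrier[OF rI e(1) _ e(2)] I(2) by (simp add: maximal_right_ideal_def)
  qed
  then show "jacobson_radical R = carrier R" by (auto simp: jacobson_radical_def)
qed

end

theorem radical_ring_iff_adjoint_group:
  "radical_ring R \<longleftrightarrow> nonunital_ring R \<and> group (adjoint_group R)"
  using nonunital_ring.jacobson_radical_eq_carrier_iff by (auto simp: radical_ring_def)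


section \<open>Pruefer rank and smallness\<close>

text \<open>The direct sum of \<open>r\<close> cyclic groups of orders \<open>p ^ k i\<close>; as the sum is finite it is the
  product group. The factors are nontrivial because \<open>k i > 0\<close>.\<close>

definition cyclic_p_decomposition :: "nat \<Rightarrow> ('a, 'b) monoid_scheme \<Rightarrow> nat \<Rightarrow> bool" where
  "cyclic_p_decomposition p G r \<longleftrightarrow>
     (\<exists>k :: nat \<Rightarrow> nat. (\<forall>i<r. k i > 0) \<and>
        G \<cong> product_group {..<r} (\<lambda>i. integer_mod_group (p ^ k i)))"

text \<open>For a finite abelian \<open>p\<close>-group the number of factors exists and is unique; the value is
  meaningful only for such groups.\<close>

definition p_rank :: "nat \<Rightarrow> ('a, 'b) monoid_scheme \<Rightarrow> nat" where
  "p_rank p G = (THE r. cyclic_p_decomposition p G r)"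

definition small_group :: "nat \<Rightarrow> nat \<Rightarrow> ('a, 'b) monoid_scheme \<Rightarrow> bool" where
  "small_group l p G \<longleftrightarrow> p_rank p G < l * (p - 1)"


section \<open>The residue degree and module rings\<close>

definition nat_ideal :: "('a, 'b) ring_scheme \<Rightarrow> nat \<Rightarrow> 'a set" where
  "nat_ideal D p = PIdl\<^bsub>D\<^esub> ([p] \<cdot>\<^bsub>D\<^esub> \<one>\<^bsub>D\<^esub>)"

text \<open>The image of the integers; in a ring of prime characteristic \<open>p\<close> this is the copy of the
  field with \<open>p\<close> elements.\<close>

definition integer_image :: "('a, 'b) ring_scheme \<Rightarrow> 'a set" where
  "integer_image R = range (\<lambda>n :: int. [n] \<cdot>\<^bsub>R\<^esub> \<one>\<^bsub>R\<^esub>)"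

definition residue_degree :: "('a, 'b) ring_scheme \<Rightarrow> nat \<Rightarrow> nat" where
  "residue_degree D p =
     (let F = D Quot (nat_ideal D p) in ring.dim F (integer_image F) (carrier F))"

text \<open>The locale \<open>module\<close> only concerns the additive group of \<open>N\<close>.\<close>

definition module_ring :: "('d, 'e) ring_scheme \<Rightarrow> ('d, 'n, 'm) module_scheme \<Rightarrow> bool" where
  "module_ring D N \<longleftrightarrow> module D N \<and> nonunital_ring N \<and>
     (\<forall>d\<in>carrier D. \<forall>x\<in>carrier N. \<forall>y\<in>carrier N.
        d \<odot>\<^bsub>N\<^esub> (x \<otimes>\<^bsub>N\<^esub> y) = (d \<odot>\<^bsub>N\<^esub> x) \<otimes>\<^bsub>N\<^esub> y \<and>
        d \<odot>\<^bsub>N\<^esub> (x \<otimes>\<^bsub>N\<^esub> y) = x \<otimes>\<^bsub>N\<^esub> (d \<odot>\<^bsub>N\<^esub> y))"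

end

theory Submission
  imports Defs
begin

text \<open>A finite abelian \<open>p\<close>-group is determined by the orders of its subgroups of \<open>p ^ i\<close>-th powers
  (\<open>p_groups_isomorphic_if_card_powers\<close>). In the additive group these subgroups are the ideals
  \<open>p ^ i N\<close>; the point of the proof is that smallness forces \<open>(1 + N) ^ (p ^ i) = 1 + p ^ i N\<close>, an
  equality of sets (\<open>nth_powers_adj_eq\<close>).

  It suffices to show \<open>(1 + I) ^ p = 1 + p I\<close> for every ideal \<open>I\<close> of \<open>N\<close> that is stable under \<open>D\<close>. The
  middle terms of the binomial expansion of \<open>(1 + x) ^ p\<close> are multiples of \<open>p\<close>, so the only obstacle is
  \<open>x ^ p\<close>. Here the field \<open>D / p D\<close> with \<open>q = p ^ \<lambda>\<close> elements enters. If \<open>x \<in> I\<close> and \<open>x ^ (p - 1) \<notin> p I\<close>,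
  then the powers \<open>x, \<dots>, x ^ (p - 1)\<close> are linearly independent in \<open>I / p I\<close> over that field, because \<open>x\<close>
  is nilpotent. Hence \<open>I / p I\<close> has at least \<open>q ^ (p - 1)\<close> elements. But \<open>I / p I\<close> has as many elements
  as the \<open>p\<close>-torsion of \<open>I\<close>, at most \<open>p\<close> to the rank of the additive group, and smallness of that group
  says that this is less than \<open>q ^ (p - 1)\<close>. So \<open>x ^ (p - 1) \<in> p I\<close> and \<open>(1 + x) ^ p = 1 + p x + p x w\<close> with
  \<open>w \<in> I\<close>. The error term lies in \<open>p (x I)\<close>, and the ideal \<open>x I\<close> is smaller than \<open>I\<close> unless \<open>I = 0\<close>; so every element of
  \<open>1 + p I\<close> is found to be a \<open>p\<close>-th power by induction on the size of \<open>I\<close> (\<open>p_mult_subset_adj_pow\<close>).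

  If the adjoint group is the small one, the same independence argument, applied to the high powers of
  an element with \<open>x ^ p \<notin> p N\<close>, shows that the additive group is small as well
  (\<open>small_torsion_if_adj_small\<close>).

  All of this happens inside one commutative ring with unity, obtained by adjoining \<open>D\<close> to \<open>N\<close>. In it the
  \<open>D\<close>-stable ideals of \<open>N\<close> are just the ideals contained in \<open>N\<close>, and \<open>1 + N\<close> is a group of units. The
  locale \<open>quasi_regular_ideal\<close> describes this situation.\<close>

section \<open>Finite abelian p-groups\<close>

lemma (in group) int_pow_bezout_mem:
  assumes H: "subgroup H G" and g: "g \<in> carrier G" and "coprime i j"
    and "g [^] (i::int) \<in> H" "g [^] (j::int) \<in> H"
  shows "g \<in> H"
proof -
  obtain u v where uv: "u * i + v * j = 1"
    using bezout_int[of i j] assms(3) by (auto simp: coprime_iff_gcd_eq_1)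
  have "g = (g [^] i) [^] u \<otimes> (g [^] j) [^] v"
    using g uv by (simp add: int_pow_pow int_pow_mult [symmetric] mult.commute)
  then show ?thesis
    using assms subgroup.m_closed[OF H] subgroup_int_pow_closed[OF H] by metis
qed

lemma (in group) int_pow_nat_pow:
  "x \<in> carrier G \<Longrightarrow> (x [^] (a::int)) [^] (n::nat) = x [^] (a * int n)"
  by (metis int_pow_int int_pow_pow)

lemma (in group) subgroup_subset_set_mult:
  assumes A: "subgroup A G" and B: "subgroup B G"
  shows "A \<subseteq> A <#> B" "B \<subseteq> A <#> B"
  using subgroup.one_closed[OF A] subgroup.one_closed[OF B]
    subgroup.mem_carrier[OF A] subgroup.mem_carrier[OF B]
  by (force simp: set_mult_def)+

text \<open>The complement is a subgroup \<open>H\<close> maximal with \<open>C \<inter> H = 1\<close>. If \<open>C H\<close> missed an element, there would be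
  \<open>y \<notin> C H\<close> with \<open>y ^ p = x ^ a h\<close>, \<open>h \<in> H\<close>. Raising this to the power \<open>p ^ (k - 1)\<close> shows, as no element
  has order above \<open>p ^ k\<close>, that \<open>p\<close> divides \<open>a\<close>; then \<open>y\<close> can be corrected by a power of \<open>x\<close> so that its
  \<open>p\<close>-th power lies in \<open>H\<close>, and adding it to \<open>H\<close> contradicts maximality.\<close>

lemma (in comm_group) maximal_order_powers_complemented:
  assumes fin: "finite (carrier G)" and p: "Factorial_Ring.prime p"
    and exp: "\<And>g. g \<in> carrier G \<Longrightarrow> g [^] (p ^ k) = \<one>"
    and x: "x \<in> carrier G" and ord: "ord x = p ^ k"
  defines "C \<equiv> range (\<lambda>i::int. x [^] i)"
  obtains H where "subgroup H G" "C \<inter> H = {\<one>}" "C <#> H = carrier G"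
proof -
  define S where "S = {H. subgroup H G \<and> C \<inter> H = {\<one>}}"
  have C: "subgroup C G" unfolding C_def by (rule subgroup_of_powers[OF x])
  have "S \<subseteq> Pow (carrier G)" by (auto simp: S_def dest: subgroup.subset)
  then have finS: "finite S" using fin finite_subset by blast
  have "{\<one>} \<in> S"
    using subgroup.one_closed[OF C] by (auto simp: S_def triv_subgroup)
  then obtain H where HS: "H \<in> S" and max: "\<And>K. \<lbrakk>K \<in> S; H \<subseteq> K\<rbrakk> \<Longrightarrow> K = H"
    using finite_has_maximal[OF finS] by blast
  then have H: "subgroup H G" and CH: "C \<inter> H = {\<one>}" by (auto simp: S_def)
  note Hc = subgroup.mem_carrier[OF H]
  let ?M = "C <#> H"
  have M: "subgroup ?M G" by (rule mult_subgroups[OF C H])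
  note CM = subgroup_subset_set_mult(1)[OF C H] and HM = subgroup_subset_set_mult(2)[OF C H]
  have "?M = carrier G"
  proof (rule ccontr)
    assume "?M \<noteq> carrier G"
    then obtain g where g: "g \<in> carrier G" "g \<notin> ?M"
      using subgroup.subset[OF M] by blast
    \<comment> \<open>the last power in the chain \<open>g, g ^ p, g ^ (p ^ 2), \<dots>\<close> outside \<open>C H\<close> serves as \<open>y\<close>\<close>
    define j where "j = (LEAST j. g [^] (p ^ j) \<in> ?M)"
    have ex: "g [^] (p ^ k) \<in> ?M" using exp[OF g(1)] subgroup.one_closed[OF M] by simp
    have j: "g [^] (p ^ j) \<in> ?M" "\<And>i. i < j \<Longrightarrow> g [^] (p ^ i) \<notin> ?M"
      using LeastI[of "\<lambda>j. g [^] (p ^ j) \<in> ?M", OF ex]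
        not_less_Least[of _ "\<lambda>j. g [^] (p ^ j) \<in> ?M"] by (auto simp: j_def)
    have "j \<noteq> 0" using j(1) g by (auto intro: ccontr)
    define y where "y = g [^] (p ^ (j - 1))"
    have y: "y \<in> carrier G" "y \<notin> ?M" "y [^] p \<in> ?M"
      using g \<open>j \<noteq> 0\<close> j(1) j(2)[of "j - 1"]
      by (auto simp: y_def nat_pow_pow power_eq_if mult.commute)
    have "k \<noteq> 0"
    proof
      assume "k = 0"
      then have "y = \<one>" using exp[OF y(1)] y(1) by simp
      then show False using y(2) subgroup.one_closed[OF M] by simp
    qed
    obtain a h where ah: "h \<in> H" "y [^] p = x [^] (a::int) \<otimes> h"
      using y(3) by (auto simp: set_mult_def C_def)
    have "\<one> = (y [^] p) [^] (p ^ (k - 1))"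
      using exp[OF y(1)] y(1) \<open>k \<noteq> 0\<close> by (simp add: nat_pow_pow power_eq_if)
    also have "\<dots> = x [^] (a * int (p ^ (k - 1))) \<otimes> h [^] (p ^ (k - 1))"
      using x Hc[OF ah(1)] by (simp only: ah(2) nat_pow_distrib int_pow_closed int_pow_nat_pow)
    finally have e: "x [^] (a * int (p ^ (k - 1))) \<otimes> h [^] (p ^ (k - 1)) = \<one>" by simp
    have hh: "h [^] (p ^ (k - 1)) \<in> H"
      using ah(1) H by (metis int_pow_int subgroup_int_pow_closed)
    have "x [^] (a * int (p ^ (k - 1))) = inv (h [^] (p ^ (k - 1)))"
      using e x Hc[OF ah(1)] by (simp add: inv_equality)
    then have "x [^] (a * int (p ^ (k - 1))) \<in> C \<inter> H"
      using subgroup.m_inv_closed[OF H hh] unfolding C_def by (metis IntI rangeI)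
    then have "x [^] (a * int (p ^ (k - 1))) = \<one>" using CH by blast
    then have "int (p ^ k) dvd a * int (p ^ (k - 1))"
      using x ord by (simp add: int_pow_eq_id)
    moreover have "int (p ^ k) = int p * int (p ^ (k - 1))"
      using \<open>k \<noteq> 0\<close> by (simp add: power_eq_if)
    ultimately have "int p dvd a" using prime_gt_0_nat[OF p] by simp
    then obtain b where b: "a = int p * b" by (auto simp: dvd_def)
    \<comment> \<open>dividing by \<open>x ^ b\<close> removes the contribution \<open>x ^ a = (x ^ b) ^ p\<close> from the \<open>p\<close>-th power\<close>
    define z where "z = x [^] (- b) \<otimes> y"
    have z: "z \<in> carrier G" using x y by (simp add: z_def)
    have "z \<notin> ?M"
    proof
      assume "z \<in> ?M"
      moreover have "x [^] b \<in> ?M" using CM by (auto simp: C_def)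
      ultimately have "x [^] b \<otimes> z \<in> ?M" using subgroup.m_closed[OF M] by blast
      moreover have "x [^] b \<otimes> z = y"
        using x y(1) by (simp add: z_def int_pow_neg flip: m_assoc)
      ultimately show False using y(2) by simp
    qed
    have zp: "z [^] p = h"
    proof -
      have "z [^] p = x [^] (- a) \<otimes> y [^] p"
        using x y(1) b by (simp add: z_def nat_pow_distrib int_pow_nat_pow mult.commute)
      also have "\<dots> = h"
        using x Hc[OF ah(1)] by (simp add: ah int_pow_neg flip: m_assoc)
      finally show ?thesis .
    qed
    let ?Z = "range (\<lambda>i::int. z [^] i)"
    have Z: "subgroup ?Z G" by (rule subgroup_of_powers[OF z])
    have "?Z <#> H \<in> S"
      unfolding S_def mem_Collect_eq
    proof (intro conjI mult_subgroups[OF Z H] equalityI subsetI)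
      fix w assume "w \<in> C \<inter> (?Z <#> H)"
      then obtain i h' where w: "w \<in> C" "w = z [^] (i::int) \<otimes> h'" "h' \<in> H"
        by (auto simp: set_mult_def)
      have "z [^] i = w \<otimes> inv h'"
        using w z Hc[OF w(3)] by (simp add: m_assoc)
      then have zi: "z [^] i \<in> ?M"
        using w subgroup.m_inv_closed[OF H w(3)] by (auto simp: set_mult_def)
      have "int p dvd i"
      proof (rule ccontr)
        assume "\<not> int p dvd i"
        then have "coprime i (int p)"
          using p prime_imp_coprime[of "int p" i] by (simp add: coprime_commute)
        then show False
          using int_pow_bezout_mem[OF M z _ zi, of "int p"] zp ah(1) HM \<open>z \<notin> ?M\<close>
          unfolding int_pow_int by blast
      qed
      then obtain m where m: "i = int p * m" by (auto simp: dvd_def)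
      have "z [^] i = h [^] m"
        using z by (simp add: m int_pow_int flip: zp int_pow_pow)
      then have "w \<in> H"
        using w subgroup.m_closed[OF H] subgroup_int_pow_closed[OF H ah(1)] by simp
      then show "w \<in> {\<one>}" using w(1) CH by blast
    next
      fix w assume "w \<in> {\<one>}"
      then show "w \<in> C \<inter> (?Z <#> H)"
        using subgroup.one_closed[OF C] subgroup.one_closed[OF mult_subgroups[OF Z H]] by simp
    qed
    moreover have "H \<subseteq> ?Z <#> H"
      by (rule subgroup_subset_set_mult(2)[OF Z H])
    ultimately have "?Z <#> H = H" using max by blast
    moreover have "z \<in> ?Z <#> H"
      using subgroup_subset_set_mult(1)[OF Z H] z by (metis int_pow_1 rangeI subsetD)
    ultimately show False using \<open>z \<notin> ?M\<close> HM by blast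
  qed
  then show thesis using that H CH by blast
qed

text \<open>The last property says that \<open>p ^ k\<close> is the exponent of the group. It makes \<open>k\<close> the same for two groups
  with equally many \<open>p ^ i\<close>-th powers, so that the cyclic factors split off from them agree.\<close>

lemma (in comm_group) p_group_split_cyclic:
  assumes p: "Factorial_Ring.prime p" and ord: "order G = p ^ n"
  obtains k H where "subgroup H G"
    and "integer_mod_group (p ^ k) \<times>\<times> (G\<lparr>carrier := H\<rparr>) \<cong> G"
    and "\<And>j. (\<forall>g\<in>carrier G. g [^] (p ^ j) = \<one>) \<longleftrightarrow> k \<le> j"
proof -
  have fin: "finite (carrier G)"
    using ord prime_gt_0_nat[OF p] by (intro order_gt_0_iff_finite[THEN iffD1]) simp
  define Q where "Q = (\<lambda>j. \<forall>g\<in>carrier G. g [^] (p ^ j) = \<one>)"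
  have "Q n" using pow_order_eq_1 ord by (simp add: Q_def)
  define k where "k = (LEAST j. Q j)"
  have Qk: "Q k" and least: "\<And>j. Q j \<Longrightarrow> k \<le> j"
    unfolding k_def using LeastI[of Q n] \<open>Q n\<close> Least_le[of Q] by auto
  have iff: "Q j \<longleftrightarrow> k \<le> j" for j
  proof
    assume "k \<le> j"
    then have "p ^ j = p ^ k * p ^ (j - k)" by (simp flip: power_add)
    then show "Q j" using Qk by (simp add: Q_def flip: nat_pow_pow)
  qed (rule least)
  have "\<exists>x\<in>carrier G. ord x = p ^ k"
  proof (cases k)
    case 0
    then show ?thesis by (intro bexI[of _ \<one>]) simp_all
  next
    case (Suc i)
    then have "\<not> Q i" using iff by simp
    then obtain x where x: "x \<in> carrier G" "x [^] (p ^ i) \<noteq> \<one>" by (auto simp: Q_def)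
    have "ord x dvd p ^ k" using Qk x by (simp add: Q_def flip: pow_eq_id)
    then obtain j where j: "j \<le> k" "ord x = p ^ j"
      using divides_primepow_nat[OF p] by blast
    moreover have "\<not> j \<le> i" using x j(2) by (auto simp: pow_eq_id le_imp_power_dvd)
    ultimately have "j = k" using Suc by simp
    then show ?thesis using x(1) j(2) by blast
  qed
  then obtain x where x: "x \<in> carrier G" "ord x = p ^ k" by blast
  let ?C = "range (\<lambda>i::int. x [^] i)"
  obtain H where H: "subgroup H G" "?C \<inter> H = {\<one>}" "?C <#> H = carrier G"
    using maximal_order_powers_complemented[OF fin p _ x] Qk by (auto simp: Q_def)
  note Hc = subgroup.mem_carrier[OF H(1)]
  let ?q = "int (p ^ k)"
  have q: "?q > 0" using prime_gt_0_nat[OF p] by simp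
  let ?Z = "integer_mod_group (p ^ k)"
  have Zc: "carrier ?Z = {0..<?q}" using q by (simp add: carrier_integer_mod_group)
  have xmod: "x [^] (i mod ?q) = x [^] i" for i :: int
    using x by (simp add: int_pow_eq mod_eq_dvd_iff[symmetric])
  let ?f = "\<lambda>(i::int, h). x [^] i \<otimes> h"
  have "?f \<in> iso (?Z \<times>\<times> (G\<lparr>carrier := H\<rparr>)) G"
  proof (rule isoI)
    show "?f \<in> hom (?Z \<times>\<times> (G\<lparr>carrier := H\<rparr>)) G"
    proof (rule homI)
      fix u v assume uv: "u \<in> carrier (?Z \<times>\<times> (G\<lparr>carrier := H\<rparr>))" "v \<in> carrier (?Z \<times>\<times> (G\<lparr>carrier := H\<rparr>))"
      then show "?f u \<in> carrier G" using x Hc by auto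
      obtain i h j h' where e: "u = (i, h)" "v = (j, h')" by fastforce
      have hh: "h \<in> carrier G" "h' \<in> carrier G" using uv e Hc by auto
      have "?f (u \<otimes>\<^bsub>?Z \<times>\<times> (G\<lparr>carrier := H\<rparr>)\<^esub> v) = x [^] ((i + j) mod ?q) \<otimes> (h \<otimes> h')"
        by (simp add: e)
      also have "\<dots> = x [^] (i + j) \<otimes> (h \<otimes> h')" by (simp only: xmod)
      also have "\<dots> = ?f u \<otimes> ?f v"
        using x hh by (simp add: e int_pow_mult m_ac)
      finally show "?f (u \<otimes>\<^bsub>?Z \<times>\<times> (G\<lparr>carrier := H\<rparr>)\<^esub> v) = ?f u \<otimes> ?f v" .
    qed
    have "inj_on ?f ({0..<?q} \<times> H)"
    proof (rule inj_onI, clarify)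
      fix i h j h' assume ij: "i \<in> {0..<?q}" "j \<in> {0..<?q}" and hh: "h \<in> H" "h' \<in> H"
        and e: "x [^] i \<otimes> h = x [^] j \<otimes> h'"
      have "x [^] (i - j) = h' \<otimes> inv h"
      proof -
        have "x [^] i = x [^] j \<otimes> h' \<otimes> inv h"
          using e x hh Hc by (metis inv_solve_right int_pow_closed m_closed)
        then have "inv (x [^] j) \<otimes> x [^] i = h' \<otimes> inv h"
          using x hh Hc by (simp add: m_assoc inv_solve_left')
        then show ?thesis using x by (simp add: int_pow_diff m_comm)
      qed
      moreover have "h' \<otimes> inv h \<in> H"
        using hh H(1) by (simp add: subgroup.m_closed subgroup.m_inv_closed)
      ultimately have "x [^] (i - j) \<in> ?C \<inter> H" by (metis IntI rangeI)
      then have "x [^] (i - j) = \<one>" using H(2) by blast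
      then have "?q dvd i - j" using x by (simp add: int_pow_eq_id)
      then have "i mod ?q = j mod ?q" by (simp only: mod_eq_dvd_iff)
      then have "i = j" using ij by simp
      then show "i = j \<and> h = h'" using e x hh Hc by simp
    qed
    moreover have "?f ` ({0..<?q} \<times> H) = carrier G"
    proof
      show "?f ` ({0..<?q} \<times> H) \<subseteq> carrier G" using x Hc by auto
      show "carrier G \<subseteq> ?f ` ({0..<?q} \<times> H)"
      proof
        fix g assume "g \<in> carrier G"
        then obtain i h where g: "g = x [^] (i::int) \<otimes> h" "h \<in> H"
          using H(3) unfolding set_mult_def by blast
        have "g = ?f (i mod ?q, h)" by (simp only: g xmod prod.case)
        moreover have "i mod ?q \<in> {0..<?q}" using q by simp
        ultimately show "g \<in> ?f ` ({0..<?q} \<times> H)" using g(2) by blast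
      qed
    qed
    ultimately show "bij_betw ?f (carrier (?Z \<times>\<times> (G\<lparr>carrier := H\<rparr>))) (carrier G)"
      by (simp add: bij_betw_def Zc)
  qed
  then have "?Z \<times>\<times> (G\<lparr>carrier := H\<rparr>) \<cong> G" by (auto simp: is_iso_def)
  then show thesis using that H(1) iff by (auto simp: Q_def)
qed

lemma (in comm_group) subgroup_imp_comm_group:
  assumes "subgroup H G"
  shows "comm_group (G\<lparr>carrier := H\<rparr>)"
  using subgroup.subgroup_is_group[OF assms group_axioms] subgroup.mem_carrier[OF assms]
  by (auto intro!: group.group_comm_groupI simp: m_comm)

definition nth_powers :: "('a, 'b) monoid_scheme \<Rightarrow> nat \<Rightarrow> 'a set" where
  "nth_powers G m = (\<lambda>x. x [^]\<^bsub>G\<^esub> m) ` carrier G"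

lemma (in monoid) nth_powers_1: "nth_powers G 1 = carrier G"
  using nat_pow_eone by (simp add: nth_powers_def cong: image_cong)

lemma (in monoid) nth_powers_mult:
  "nth_powers G (m * n) = (\<lambda>x. x [^] n) ` nth_powers G m"
  unfolding nth_powers_def image_image by (intro image_cong) (simp_all add: nat_pow_pow)

text \<open>The nonempty fibres of the power endomorphism are cosets of its kernel. Applied to the additive and
  to the adjoint group, this is what relates torsion to indices below.\<close>

lemma (in comm_group) card_vimage_pow:
  assumes fin: "finite (carrier G)"
  shows "card {x \<in> carrier G. x [^] (n::nat) \<in> V}
      = card {x \<in> carrier G. x [^] n = \<one>} * card (V \<inter> nth_powers G n)"
proof -
  let ?F = "\<lambda>v. {x \<in> carrier G. x [^] n = v}"
  have fibre: "card (?F v) = card (?F \<one>)" if v: "v \<in> nth_powers G n" for v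
  proof -
    obtain y where y: "y \<in> carrier G" "v = y [^] n" using v by (auto simp: nth_powers_def)
    have "bij_betw (\<lambda>x. y \<otimes> x) (?F \<one>) (?F v)"
    proof (rule bij_betw_byWitness[where f' = "\<lambda>x. inv y \<otimes> x"])
      show "\<forall>x\<in>?F \<one>. inv y \<otimes> (y \<otimes> x) = x" "\<forall>x\<in>?F v. y \<otimes> (inv y \<otimes> x) = x"
        using y(1) by (simp_all flip: m_assoc)
      show "(\<otimes>) y ` ?F \<one> \<subseteq> ?F v" "(\<otimes>) (inv y) ` ?F v \<subseteq> ?F \<one>"
        using y by (auto simp: nat_pow_distrib nat_pow_inv)
    qed
    then show ?thesis by (rule bij_betw_same_card[symmetric])
  qed
  have "{x \<in> carrier G. x [^] n \<in> V} = (\<Union>v\<in>V \<inter> nth_powers G n. ?F v)"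
    by (auto simp: nth_powers_def)
  also have "card \<dots> = (\<Sum>v\<in>V \<inter> nth_powers G n. card (?F v))"
    using fin by (intro card_UN_disjoint) (auto simp: nth_powers_def)
  also have "\<dots> = (\<Sum>v\<in>V \<inter> nth_powers G n. card (?F \<one>))"
    by (intro sum.cong refl fibre) blast
  finally show ?thesis by simp
qed

lemma card_nth_powers_iso:
  assumes "group G" "group H" "G \<cong> H"
  shows "card (nth_powers G m) = card (nth_powers H m)"
proof -
  obtain f where f: "f \<in> iso G H" using assms(3) by (auto simp: is_iso_def)
  interpret group_hom G H f
    using assms f by (simp add: group_hom_def group_hom_axioms_def iso_def)
  have b: "bij_betw f (carrier G) (carrier H)" using f by (simp add: iso_def)
  have "f ` nth_powers G m = (\<lambda>x. f x [^]\<^bsub>H\<^esub> m) ` carrier G"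
    unfolding nth_powers_def image_image by (rule image_cong) (simp_all add: hom_nat_pow)
  also have "\<dots> = nth_powers H m"
    unfolding nth_powers_def bij_betw_imp_surj_on[OF b, symmetric] image_image ..
  finally have "f ` nth_powers G m = nth_powers H m" .
  moreover have "inj_on f (nth_powers G m)"
    using bij_betw_imp_inj_on[OF b] by (rule inj_on_subset) (auto simp: nth_powers_def)
  ultimately show ?thesis by (metis card_image)
qed

lemma DirProd_nat_pow:
  "x [^]\<^bsub>G \<times>\<times> H\<^esub> (m::nat) = (fst x [^]\<^bsub>G\<^esub> m, snd x [^]\<^bsub>H\<^esub> m)"
  by (induction m) (auto simp: mult_DirProd')

lemma card_nth_powers_DirProd:
  "card (nth_powers (G \<times>\<times> H) m) = card (nth_powers G m) * card (nth_powers H m)"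
proof -
  have "nth_powers (G \<times>\<times> H) m = map_prod (\<lambda>x. x [^]\<^bsub>G\<^esub> m) (\<lambda>x. x [^]\<^bsub>H\<^esub> m) ` (carrier G \<times> carrier H)"
    unfolding nth_powers_def by (rule image_cong) (auto simp: DirProd_nat_pow)
  then have "nth_powers (G \<times>\<times> H) m = nth_powers G m \<times> nth_powers H m"
    by (simp add: nth_powers_def map_prod_surj_on)
  then show ?thesis by (simp add: card_cartesian_product)
qed

lemma (in group) card_nth_powers_eq_1_iff:
  "card (nth_powers G m) = 1 \<longleftrightarrow> (\<forall>g\<in>carrier G. g [^] m = \<one>)"
proof
  assume "card (nth_powers G m) = 1"
  then obtain a where a: "nth_powers G m = {a}" by (rule card_1_singletonE)
  then show "\<forall>g\<in>carrier G. g [^] m = \<one>"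
    by (metis image_eqI nat_pow_one nth_powers_def one_closed singletonD)
next
  assume "\<forall>g\<in>carrier G. g [^] m = \<one>"
  then have "nth_powers G m = {\<one>}" by (force simp: nth_powers_def)
  then show "card (nth_powers G m) = 1" by simp
qed

lemma p_group_split_factor_order:
  assumes p: "Factorial_Ring.prime p" and ord: "order G = p ^ n"
    and iso: "integer_mod_group (p ^ k) \<times>\<times> K \<cong> G"
  obtains m where "order K = p ^ m" "k \<noteq> 0 \<Longrightarrow> order K < order G"
proof -
  have "p ^ n = p ^ k * order K"
    using iso_same_card[OF iso] ord prime_gt_0_nat[OF p]
    by (simp add: order_def card_cartesian_product carrier_integer_mod_group nat_power_eq)
  then have e: "p ^ n = p ^ k * order K" "order K dvd p ^ n" by auto
  obtain m where m: "order K = p ^ m" using divides_primepow_nat[OF p] e(2) by blast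
  have "order K < order G" if "k \<noteq> 0"
  proof -
    have "1 < p ^ k" using that one_less_power[OF prime_gt_1_nat[OF p], of k] by simp
    moreover have "0 < order K" using m prime_gt_0_nat[OF p] by simp
    ultimately have "order K * 1 < order K * p ^ k" by (rule mult_strict_left_mono)
    then show ?thesis using ord e(1) by (simp add: mult.commute)
  qed
  with m show thesis by (rule that)
qed

text \<open>Both groups lose isomorphic cyclic factors, and the numbers of powers are multiplicative, so the
  complements again satisfy the hypothesis; unless the groups are trivial, their order is smaller.\<close>

lemma p_groups_isomorphic_if_card_powers:
  fixes G :: "('a, 'c) monoid_scheme" and H :: "('b, 'd) monoid_scheme"
  assumes p: "Factorial_Ring.prime p"
    and "comm_group G" "order G = p ^ n" "comm_group H" "order H = p ^ m"
    and "\<And>i. card (nth_powers G (p ^ i)) = card (nth_powers H (p ^ i))"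
  shows "G \<cong> H"
  using assms(2-)
proof (induction "order G" arbitrary: G H n m rule: less_induct)
  case less
  interpret G: comm_group G by fact
  interpret H: comm_group H by fact
  obtain k A where A: "subgroup A G" and isoG: "integer_mod_group (p ^ k) \<times>\<times> (G\<lparr>carrier := A\<rparr>) \<cong> G"
    and k: "\<And>j. (\<forall>g\<in>carrier G. g [^]\<^bsub>G\<^esub> (p ^ j) = \<one>\<^bsub>G\<^esub>) \<longleftrightarrow> k \<le> j"
    by (rule G.p_group_split_cyclic[OF p less.prems(2)]) blast
  obtain l B where B: "subgroup B H" and isoH: "integer_mod_group (p ^ l) \<times>\<times> (H\<lparr>carrier := B\<rparr>) \<cong> H"
    and l: "\<And>j. (\<forall>g\<in>carrier H. g [^]\<^bsub>H\<^esub> (p ^ j) = \<one>\<^bsub>H\<^esub>) \<longleftrightarrow> l \<le> j"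
    by (rule H.p_group_split_cyclic[OF p less.prems(4)]) blast
  have "k \<le> j \<longleftrightarrow> l \<le> j" for j
    by (simp only: k[symmetric] l[symmetric] G.card_nth_powers_eq_1_iff[symmetric]
        H.card_nth_powers_eq_1_iff[symmetric] less.prems(5))
  then have lk: "l = k" by (meson order_antisym order_refl)
  show ?case
  proof (cases "k = 0")
    case True
    have tG: "carrier G = {\<one>\<^bsub>G\<^esub>}" using k[of 0] True by auto
    have tH: "carrier H = {\<one>\<^bsub>H\<^esub>}" using l[of 0] True lk by auto
    have "(\<lambda>_. \<one>\<^bsub>H\<^esub>) \<in> iso G H"
      by (rule isoI) (auto simp: hom_def bij_betw_def tG tH)
    then show ?thesis by (auto simp: is_iso_def)
  next
    case False
    let ?A = "G\<lparr>carrier := A\<rparr>" and ?B = "H\<lparr>carrier := B\<rparr>" and ?Z = "integer_mod_group (p ^ k)"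
    note isoH = isoH[unfolded lk]
    have cA: "comm_group ?A" by (rule G.subgroup_imp_comm_group[OF A])
    have cB: "comm_group ?B" by (rule H.subgroup_imp_comm_group[OF B])
    interpret A: comm_group ?A by (rule cA)
    interpret B: comm_group ?B by (rule cB)
    obtain n' where n': "order ?A = p ^ n'" "order ?A < order G"
      using p_group_split_factor_order[OF p less.prems(2) isoG] False by metis
    obtain m' where m': "order ?B = p ^ m'"
      using p_group_split_factor_order[OF p less.prems(4) isoH] by metis
    have gG: "group (?Z \<times>\<times> ?A)" and gH: "group (?Z \<times>\<times> ?B)"
      by (auto intro: DirProd_group)
    have "card (nth_powers ?A (p ^ i)) = card (nth_powers ?B (p ^ i))" for i
    proof -
      have "card (nth_powers ?Z (p ^ i)) * card (nth_powers ?A (p ^ i))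
          = card (nth_powers ?Z (p ^ i)) * card (nth_powers ?B (p ^ i))"
        using less.prems(5)[of i] card_nth_powers_iso[OF gG G.group_axioms isoG, of "p ^ i"]
          card_nth_powers_iso[OF gH H.group_axioms isoH, of "p ^ i"]
        by (simp add: card_nth_powers_DirProd)
      moreover have "card (nth_powers ?Z (p ^ i)) > 0"
        using prime_gt_0_nat[OF p] by (simp add: nth_powers_def card_gt_0_iff carrier_integer_mod_group)
      ultimately show ?thesis by simp
    qed
    then have AB: "?A \<cong> ?B" using less.hyps[OF n'(2) cA n'(1) cB m'] by blast
    have "G \<cong> ?Z \<times>\<times> ?A" using group.iso_sym[OF gG isoG] .
    also have "\<dots> \<cong> ?Z \<times>\<times> ?B"
      using group.DirProd_iso_trans[OF group_integer_mod_group iso_refl AB] .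
    also note isoH
    finally show ?thesis .
  qed
qed

lemma product_group_lessThan_Suc:
  "F r \<times>\<times> product_group {..<r} F \<cong> product_group {..<Suc r} F"
proof -
  let ?f = "\<lambda>(y, x). x(r := y)"
  have "?f \<in> iso (F r \<times>\<times> product_group {..<r} F) (product_group {..<Suc r} F)"
  proof (rule isoI)
    show "?f \<in> hom (F r \<times>\<times> product_group {..<r} F) (product_group {..<Suc r} F)"
    proof (rule homI)
      fix u v assume "u \<in> carrier (F r \<times>\<times> product_group {..<r} F)"
        "v \<in> carrier (F r \<times>\<times> product_group {..<r} F)"
      then show "?f u \<in> carrier (product_group {..<Suc r} F)"
        by (auto simp: lessThan_Suc PiE_insert_eq)
      show "?f (u \<otimes>\<^bsub>F r \<times>\<times> product_group {..<r} F\<^esub> v) = ?f u \<otimes>\<^bsub>product_group {..<Suc r} F\<^esub> ?f v"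
        by (cases u, cases v) (simp add: fun_eq_iff restrict_def less_Suc_eq)
    qed
    show "bij_betw ?f (carrier (F r \<times>\<times> product_group {..<r} F)) (carrier (product_group {..<Suc r} F))"
      unfolding bij_betw_def carrier_DirProd carrier_product_group lessThan_Suc
      by (intro conjI inj_combinator PiE_insert_eq[symmetric]) simp
  qed
  then show ?thesis by (auto simp: is_iso_def)
qed

lemma cyclic_p_decomposition_exists:
  fixes G :: "('a, 'c) monoid_scheme"
  assumes p: "Factorial_Ring.prime p" and "comm_group G" "order G = p ^ n"
  shows "\<exists>r. cyclic_p_decomposition p G r"
  using assms(2-)
proof (induction "order G" arbitrary: G n rule: less_induct)
  case less
  interpret G: comm_group G by fact
  obtain k A where A: "subgroup A G" and isoG: "integer_mod_group (p ^ k) \<times>\<times> (G\<lparr>carrier := A\<rparr>) \<cong> G"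
    and k: "\<And>j. (\<forall>g\<in>carrier G. g [^]\<^bsub>G\<^esub> (p ^ j) = \<one>\<^bsub>G\<^esub>) \<longleftrightarrow> k \<le> j"
    by (rule G.p_group_split_cyclic[OF p less.prems(2)]) blast
  let ?A = "G\<lparr>carrier := A\<rparr>" and ?Z = "integer_mod_group (p ^ k)"
  show ?case
  proof (cases "k = 0")
    case True
    have tG: "carrier G = {\<one>\<^bsub>G\<^esub>}" using k[of 0] True by auto
    have "(\<lambda>_ _. undefined) \<in> iso G (product_group {..<0::nat} (\<lambda>i. integer_mod_group (p ^ i)))"
      by (rule isoI) (auto simp: hom_def bij_betw_def tG)
    then have "cyclic_p_decomposition p G 0"
      by (auto simp: cyclic_p_decomposition_def is_iso_def)
    then show ?thesis ..
  next
    case False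
    interpret A: comm_group ?A by (rule G.subgroup_imp_comm_group[OF A])
    obtain n' where n': "order ?A = p ^ n'" "order ?A < order G"
      using p_group_split_factor_order[OF p less.prems(2) isoG] False by metis
    obtain r where "cyclic_p_decomposition p ?A r"
      using less.hyps[OF n'(2) A.comm_group_axioms n'(1)] ..
    then obtain e where e: "\<forall>i<r. e i > 0"
      and iso: "?A \<cong> product_group {..<r} (\<lambda>i. integer_mod_group (p ^ e i))"
      unfolding cyclic_p_decomposition_def by (elim exE conjE)
    let ?F = "\<lambda>i. integer_mod_group (p ^ (e(r := k)) i)"
    have eq: "product_group {..<r} (\<lambda>i. integer_mod_group (p ^ e i)) = product_group {..<r} ?F"
      unfolding product_group_def by (simp cong: restrict_cong) (rule PiE_cong, simp)
    have "G \<cong> ?Z \<times>\<times> ?A"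
      using group.iso_sym[OF DirProd_group isoG] A.group_axioms by simp
    also have "\<dots> \<cong> ?F r \<times>\<times> product_group {..<r} ?F"
      using group.DirProd_iso_trans[OF group_integer_mod_group iso_refl iso]
      by (simp only: eq fun_upd_same)
    also have "\<dots> \<cong> product_group {..<Suc r} ?F" by (rule product_group_lessThan_Suc)
    finally have "cyclic_p_decomposition p G (Suc r)"
      unfolding cyclic_p_decomposition_def using e False
      by (intro exI[of _ "e(r := k)"]) (simp add: less_Suc_eq)
    then show ?thesis ..
  qed
qed

lemma product_group_nat_pow:
  "x \<in> carrier (product_group I F) \<Longrightarrow>
    x [^]\<^bsub>product_group I F\<^esub> (m::nat) = (\<lambda>i\<in>I. x i [^]\<^bsub>F i\<^esub> m)"
  by (induction m) (auto simp: fun_eq_iff)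

lemma card_torsion_integer_mod_group:
  assumes p: "Factorial_Ring.prime p" and "k > 0"
  shows "card {x \<in> carrier (integer_mod_group (p ^ k)). x [^]\<^bsub>integer_mod_group (p ^ k)\<^esub> p = \<one>\<^bsub>integer_mod_group (p ^ k)\<^esub>} = p"
proof -
  let ?q = "int p ^ (k - 1)"
  have q: "?q > 0" "int p ^ k = int p * ?q" and p0: "int p > 0"
    using assms prime_gt_0_nat[OF p] by (auto simp flip: power_Suc)
  have "{x \<in> carrier (integer_mod_group (p ^ k)). x [^]\<^bsub>integer_mod_group (p ^ k)\<^esub> p = \<one>\<^bsub>integer_mod_group (p ^ k)\<^esub>}
      = {x. 0 \<le> x \<and> x < int p * ?q \<and> ?q dvd x}"
    using p0 unfolding carrier_integer_mod_group pow_integer_mod_group one_integer_mod_group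
    by (simp add: q(2) mod_eq_0_iff_dvd)
  also have "\<dots> = (\<lambda>i. ?q * i) ` {0..<int p}"
  proof (intro equalityI subsetI)
    fix x assume x: "x \<in> {x. 0 \<le> x \<and> x < int p * ?q \<and> ?q dvd x}"
    then obtain i where i: "x = ?q * i" by (auto simp: dvd_def)
    have "0 \<le> ?q * i" "?q * i < ?q * int p" using x i by (simp_all add: mult.commute)
    then have "0 \<le> i" "i < int p"
      using mult_le_cancel_left_pos[OF q(1), of 0 i] mult_less_cancel_left_pos[OF q(1), of i "int p"] by simp_all
    then show "x \<in> (\<lambda>i. ?q * i) ` {0..<int p}" using i by simp
  next
    fix x assume "x \<in> (\<lambda>i. ?q * i) ` {0..<int p}"
    then show "x \<in> {x. 0 \<le> x \<and> x < int p * ?q \<and> ?q dvd x}"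
      using q(1) by (auto simp: mult.commute)
  qed
  also have "card \<dots> = p"
    using q(1) by (subst card_image) (auto simp: inj_on_def)
  finally show ?thesis .
qed

lemma card_torsion_iso:
  assumes "group G" "group H" "G \<cong> H"
  shows "card {x \<in> carrier G. x [^]\<^bsub>G\<^esub> (m::nat) = \<one>\<^bsub>G\<^esub>} = card {x \<in> carrier H. x [^]\<^bsub>H\<^esub> m = \<one>\<^bsub>H\<^esub>}"
proof -
  obtain f where f: "f \<in> iso G H" using assms(3) by (auto simp: is_iso_def)
  interpret group_hom G H f
    using assms f by (simp add: group_hom_def group_hom_axioms_def iso_def)
  have b: "inj_on f (carrier G)" "f ` carrier G = carrier H" using f by (auto simp: iso_def bij_betw_def)
  have "f ` {x \<in> carrier G. x [^]\<^bsub>G\<^esub> m = \<one>\<^bsub>G\<^esub>} = {x \<in> carrier H. x [^]\<^bsub>H\<^esub> m = \<one>\<^bsub>H\<^esub>}"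
  proof (intro equalityI subsetI)
    fix y assume y: "y \<in> {x \<in> carrier H. x [^]\<^bsub>H\<^esub> m = \<one>\<^bsub>H\<^esub>}"
    then obtain x where x: "x \<in> carrier G" "y = f x" using b(2) by blast
    then have "f (x [^]\<^bsub>G\<^esub> m) = f \<one>\<^bsub>G\<^esub>" using y by (simp add: hom_nat_pow)
    then have "x [^]\<^bsub>G\<^esub> m = \<one>\<^bsub>G\<^esub>" using x(1) b(1) by (meson G.nat_pow_closed G.one_closed inj_onD)
    then show "y \<in> f ` {x \<in> carrier G. x [^]\<^bsub>G\<^esub> m = \<one>\<^bsub>G\<^esub>}" using x by blast
  qed (auto simp flip: hom_nat_pow)
  then show ?thesis using card_image[OF inj_on_subset[OF b(1)]] by (metis (no_types, lifting) mem_Collect_eq subsetI)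
qed

lemma card_torsion_cyclic_p_decomposition:
  assumes p: "Factorial_Ring.prime p" and G: "group G" and "cyclic_p_decomposition p G r"
  shows "card {x \<in> carrier G. x [^]\<^bsub>G\<^esub> p = \<one>\<^bsub>G\<^esub>} = p ^ r"
proof -
  obtain k where k: "\<forall>i<r. k i > (0::nat)"
    and iso: "G \<cong> product_group {..<r} (\<lambda>i. integer_mod_group (p ^ k i))"
    using assms(3) unfolding cyclic_p_decomposition_def by (elim exE conjE)
  let ?F = "\<lambda>i. integer_mod_group (p ^ k i)"
  let ?P = "product_group {..<r} ?F"
  have "group ?P" by simp
  have "{x \<in> carrier ?P. x [^]\<^bsub>?P\<^esub> p = \<one>\<^bsub>?P\<^esub>}
      = (\<Pi>\<^sub>E i\<in>{..<r}. {x \<in> carrier (?F i). x [^]\<^bsub>?F i\<^esub> p = \<one>\<^bsub>?F i\<^esub>})"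
  proof -
    have "x [^]\<^bsub>?P\<^esub> p = \<one>\<^bsub>?P\<^esub> \<longleftrightarrow> (\<forall>i\<in>{..<r}. x i [^]\<^bsub>?F i\<^esub> p = \<one>\<^bsub>?F i\<^esub>)"
      if "x \<in> carrier ?P" for x
      unfolding product_group_nat_pow[OF that] one_product_group
      by (metis (mono_tags, lifting) restrict_apply' restrict_ext)
    then have "{x \<in> carrier ?P. x [^]\<^bsub>?P\<^esub> p = \<one>\<^bsub>?P\<^esub>}
        = {x \<in> carrier ?P. \<forall>i\<in>{..<r}. x i [^]\<^bsub>?F i\<^esub> p = \<one>\<^bsub>?F i\<^esub>}"
      by blast
    also have "\<dots> = (\<Pi>\<^sub>E i\<in>{..<r}. {x \<in> carrier (?F i). x [^]\<^bsub>?F i\<^esub> p = \<one>\<^bsub>?F i\<^esub>})"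
      by (rule Set.set_eqI) (simp only: mem_Collect_eq carrier_product_group PiE_iff, blast)
    finally show ?thesis .
  qed
  moreover have "card \<dots> = p ^ r"
    using k by (simp add: card_PiE card_torsion_integer_mod_group[OF p] del: pow_integer_mod_group one_integer_mod_group)
  ultimately show ?thesis using card_torsion_iso[OF G \<open>group ?P\<close> iso, of p] by simp
qed

text \<open>Each cyclic factor contributes exactly \<open>p\<close> elements to the \<open>p\<close>-torsion. This makes the number of
  factors unique, hence the definite description in \<open>p_rank\<close> meaningful, and turns statements about the
  rank into statements about cardinalities.\<close>

theorem card_torsion_eq_p_rank:
  assumes p: "Factorial_Ring.prime p" and G: "comm_group G" and "order G = p ^ n"
  shows "card {x \<in> carrier G. x [^]\<^bsub>G\<^esub> p = \<one>\<^bsub>G\<^esub>} = p ^ p_rank p G"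
proof -
  note c = card_torsion_cyclic_p_decomposition[OF p comm_group.axioms(2)[OF G]]
  obtain r where r: "cyclic_p_decomposition p G r"
    using cyclic_p_decomposition_exists[OF p G assms(3)] by blast
  have "p_rank p G = r"
    unfolding p_rank_def
  proof (rule the_equality[where P = "cyclic_p_decomposition p G", OF r])
    fix s assume "cyclic_p_decomposition p G s"
    then have "p ^ s = p ^ r" using c r by metis
    then show "s = r" using prime_gt_1_nat[OF p] by simp
  qed
  then show ?thesis using c[OF r] by simp
qed

lemma cyclic_p_decomposition_iso:
  assumes "group G" "G \<cong> H" "cyclic_p_decomposition p G r"
  shows "cyclic_p_decomposition p H r"
proof -
  have "H \<cong> G" using assms by (simp add: group.iso_sym)
  then show ?thesis
    using assms(3) unfolding cyclic_p_decomposition_def by (meson iso_trans)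
qed

lemma small_group_iso:
  assumes "group G" "group H" "G \<cong> H"
  shows "small_group l p G \<longleftrightarrow> small_group l p H"
proof -
  have "cyclic_p_decomposition p G = cyclic_p_decomposition p H"
    using cyclic_p_decomposition_iso[OF assms(1,3)]
      cyclic_p_decomposition_iso[OF assms(2) group.iso_sym[OF assms(1,3)]]
    by (intro ext iffI)
  then show ?thesis by (simp add: small_group_def p_rank_def)
qed

lemma card_torsion_less_if_small:
  assumes p: "Factorial_Ring.prime p" and G: "comm_group G" "order G = p ^ n"
    and small: "small_group l p G"
  shows "card {x \<in> carrier G. x [^]\<^bsub>G\<^esub> p = \<one>\<^bsub>G\<^esub>} < (p ^ l) ^ (p - 1)"
  using small prime_gt_1_nat[OF p]
  unfolding card_torsion_eq_p_rank[OF p G] small_group_def power_mult[symmetric]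
  by (rule power_strict_increasing)

section \<open>Powers in a commutative ring\<close>

lemma (in cring) one_plus_pow:
  assumes x: "x \<in> carrier R"
  shows "(\<one> \<oplus> x) [^] (n::nat) = (\<Oplus>k\<in>{..n}. [(n choose k)] \<cdot> (x [^] k))"
proof (induction n)
  case 0
  then show ?case using x by simp
next
  case (Suc n)
  let ?c = "\<lambda>k. [(n choose k)] \<cdot> (x [^] k)" and ?d = "\<lambda>k. [(n choose k)] \<cdot> (x [^] Suc k)"
  have cl: "?c \<in> A \<rightarrow> carrier R" "?d \<in> A \<rightarrow> carrier R" for A using x by auto
  have "(\<Oplus>k\<in>{..n}. [(n choose Suc k)] \<cdot> (x [^] Suc k)) \<oplus> \<one> = (\<Oplus>k\<in>{..Suc n}. ?c k)"
    using x by (subst finsum_Suc2) auto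
  also have "\<dots> = (\<Oplus>k\<in>{..n}. ?c k)" using x cl by (subst finsum_Suc) (auto simp: binomial_eq_0)
  finally have shift: "(\<Oplus>k\<in>{..n}. [(n choose Suc k)] \<cdot> (x [^] Suc k)) \<oplus> \<one> = (\<Oplus>k\<in>{..n}. ?c k)" .
  have "(\<Oplus>k\<in>{..Suc n}. [(Suc n choose k)] \<cdot> (x [^] k))
      = (\<Oplus>k\<in>{..n}. [(Suc n choose Suc k)] \<cdot> (x [^] Suc k)) \<oplus> \<one>"
    using x by (subst finsum_Suc2) auto
  also have "(\<Oplus>k\<in>{..n}. [(Suc n choose Suc k)] \<cdot> (x [^] Suc k))
      = (\<Oplus>k\<in>{..n}. ?d k \<oplus> [(n choose Suc k)] \<cdot> (x [^] Suc k))"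
    using x by (intro finsum_cong') (auto simp: add.nat_pow_mult[symmetric])
  also have "\<dots> = (\<Oplus>k\<in>{..n}. ?d k) \<oplus> (\<Oplus>k\<in>{..n}. [(n choose Suc k)] \<cdot> (x [^] Suc k))"
    using x by (intro finsum_addf) auto
  also have "\<dots> \<oplus> \<one> = (\<Oplus>k\<in>{..n}. ?d k) \<oplus> (\<Oplus>k\<in>{..n}. ?c k)"
    using x cl by (subst a_assoc) (auto simp: shift[unfolded nat_pow_Suc])
  also have "(\<Oplus>k\<in>{..n}. ?d k) = (\<Oplus>k\<in>{..n}. ?c k) \<otimes> x"
    using x cl by (subst finsum_ldistr) (auto simp: add_pow_ldistr intro!: finsum_cong')
  also have "(\<Oplus>k\<in>{..n}. ?c k) \<otimes> x \<oplus> (\<Oplus>k\<in>{..n}. ?c k) = (\<one> \<oplus> x) [^] Suc n"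
    unfolding Suc.IH[symmetric] using x by (simp add: r_distr a_comm)
  finally show ?case by simp
qed

text \<open>The middle binomial coefficients are divisible by \<open>p\<close>. The term linear in \<open>x\<close> is separated from those
  divisible by \<open>x\<^sup>2\<close>, because it is the leading term when the expansion is read modulo the smaller ideals
  \<open>x I\<close>.\<close>

lemma (in cring) one_plus_pow_prime:
  fixes p :: nat
  assumes p: "Factorial_Ring.prime p" and x: "x \<in> carrier R"
  obtains t where "t \<in> carrier R"
    "(\<one> \<oplus> x) [^] p = \<one> \<oplus> (([p] \<cdot> \<one>) \<otimes> x \<oplus> ([p] \<cdot> \<one>) \<otimes> (x \<otimes> x \<otimes> t)) \<oplus> x [^] p"
proof -
  let ?pi = "[p] \<cdot> \<one>"
  \<comment> \<open>the partial sums of the middle terms; for \<open>p = 2\<close> only the linear term is left\<close>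
  have mid: "\<exists>t\<in>carrier R. (\<Oplus>k\<in>{..j}. [(p choose Suc k)] \<cdot> (x [^] Suc k))
      = ?pi \<otimes> x \<oplus> ?pi \<otimes> (x \<otimes> x \<otimes> t)" if "Suc j < p" for j
    using that
  proof (induction j)
    case 0
    then show ?case using x by (intro bexI[of _ \<zero>]) (auto simp: add_pow_ldistr)
  next
    case (Suc j)
    then obtain t where t: "t \<in> carrier R" "(\<Oplus>k\<in>{..j}. [(p choose Suc k)] \<cdot> (x [^] Suc k))
      = ?pi \<otimes> x \<oplus> ?pi \<otimes> (x \<otimes> x \<otimes> t)" by auto
    have "p dvd (p choose Suc (Suc j))"
      using Suc.prems by (intro dvd_choose_prime p) auto
    then obtain c where c: "p choose Suc (Suc j) = p * c" by (auto simp: dvd_def)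
    have e: "[(p choose Suc (Suc j))] \<cdot> (x [^] Suc (Suc j)) = ?pi \<otimes> (x \<otimes> x \<otimes> [c] \<cdot> (x [^] j))"
      using x by (simp add: c add_pow_ldistr add_pow_rdistr add.nat_pow_pow mult.commute m_ac)
    show ?case
    proof (intro bexI)
      show "t \<oplus> [c] \<cdot> (x [^] j) \<in> carrier R" using t x by simp
      have "(\<Oplus>k\<in>{..Suc j}. [(p choose Suc k)] \<cdot> (x [^] Suc k))
          = [(p choose Suc (Suc j))] \<cdot> (x [^] Suc (Suc j)) \<oplus> (?pi \<otimes> x \<oplus> ?pi \<otimes> (x \<otimes> x \<otimes> t))"
        using x by (subst finsum_Suc) (auto simp: t(2)[unfolded nat_pow_Suc])
      also have "\<dots> = ?pi \<otimes> x \<oplus> ?pi \<otimes> (x \<otimes> x \<otimes> (t \<oplus> [c] \<cdot> (x [^] j)))"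
        unfolding e using x t(1) by (simp add: r_distr a_ac)
      finally show "(\<Oplus>k\<in>{..Suc j}. [(p choose Suc k)] \<cdot> (x [^] Suc k))
          = ?pi \<otimes> x \<oplus> ?pi \<otimes> (x \<otimes> x \<otimes> (t \<oplus> [c] \<cdot> (x [^] j)))" .
    qed
  qed
  obtain m where m: "p = Suc (Suc m)"
    using prime_gt_1_nat[OF p] by (metis One_nat_def Suc_lessE less_imp_Suc_add)
  obtain t where t: "t \<in> carrier R" "(\<Oplus>k\<in>{..m}. [(p choose Suc k)] \<cdot> (x [^] Suc k))
      = ?pi \<otimes> x \<oplus> ?pi \<otimes> (x \<otimes> x \<otimes> t)" using mid[of m] m by auto
  have "(\<one> \<oplus> x) [^] p = (\<Oplus>k\<in>{..Suc (Suc m)}. [(p choose k)] \<cdot> (x [^] k))"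
    using one_plus_pow[OF x, of p] m by simp
  also have "\<dots> = (\<Oplus>k\<in>{..Suc m}. [(p choose Suc k)] \<cdot> (x [^] Suc k)) \<oplus> \<one>"
    using x by (subst finsum_Suc2) auto
  also have "(\<Oplus>k\<in>{..Suc m}. [(p choose Suc k)] \<cdot> (x [^] Suc k))
      = x [^] p \<oplus> (?pi \<otimes> x \<oplus> ?pi \<otimes> (x \<otimes> x \<otimes> t))"
    unfolding t(2)[symmetric] using x by (subst finsum_Suc) (auto simp del: nat_pow_Suc simp flip: m)
  also have "\<dots> \<oplus> \<one> = \<one> \<oplus> (?pi \<otimes> x \<oplus> ?pi \<otimes> (x \<otimes> x \<otimes> t)) \<oplus> x [^] p"
    using x t(1) by (simp add: a_ac)
  finally show thesis using that t(1) by blast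
qed

lemma (in cring) ideal_image_mult:
  assumes I: "ideal I R" and a: "a \<in> carrier R"
  shows "ideal ((\<otimes>) a ` I) R"
proof -
  interpret I: ideal I R by fact
  have e: "a \<otimes> y \<otimes> z = a \<otimes> (y \<otimes> z)" "z \<otimes> (a \<otimes> y) = a \<otimes> (z \<otimes> y)"
    if "y \<in> carrier R" "z \<in> carrier R" for y z
    using a that by (simp_all add: m_ac)
  show ?thesis
  proof (rule idealI)
    show "ring R" by (rule ring_axioms)
    show "subgroup ((\<otimes>) a ` I) (add_monoid R)"
    proof (rule add.subgroupI)
      show "(\<otimes>) a ` I \<subseteq> carrier R" using a I.a_subset by auto
      show "(\<otimes>) a ` I \<noteq> {}" using I.zero_closed by blast
      fix y assume "y \<in> (\<otimes>) a ` I"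
      then obtain u where u: "u \<in> I" "y = a \<otimes> u" by auto
      show "\<ominus> y \<in> (\<otimes>) a ` I"
        using a u I.a_subset by (intro image_eqI[of _ _ "\<ominus> u"]) (auto simp: r_minus)
      fix z assume "z \<in> (\<otimes>) a ` I"
      then obtain v where v: "v \<in> I" "z = a \<otimes> v" by auto
      show "y \<oplus> z \<in> (\<otimes>) a ` I"
        using a u v I.a_subset by (intro image_eqI[of _ _ "u \<oplus> v"]) (auto simp: r_distr subsetD)
    qed
  next
    fix y z assume "y \<in> (\<otimes>) a ` I" "z \<in> carrier R"
    then show "z \<otimes> y \<in> (\<otimes>) a ` I" "y \<otimes> z \<in> (\<otimes>) a ` I"
      using e I.I_l_closed I.I_r_closed I.a_subset by auto
  qed
qed

text \<open>Used with \<open>x\<close> nilpotent: above any power outside the ideal there is a last one outside it. Multiples of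
  such an \<open>x ^ m\<close> are killed by \<open>x\<close> modulo the ideal, which is the source of linear independence.\<close>

lemma (in ideal) last_power_not_mem:
  fixes k l :: nat
  assumes x: "x \<in> carrier R" and "x [^] k \<in> I" "x [^] l \<notin> I"
  obtains m :: nat where "l \<le> m" "x [^] m \<notin> I" "x [^] Suc m \<in> I"
proof -
  have "\<exists>m\<ge>l. x [^] m \<notin> I \<and> x [^] Suc m \<in> I"
  proof (rule ccontr)
    assume none: "\<not> ?thesis"
    have "x [^] (l + n) \<notin> I" for n
    proof (induction n)
      case (Suc n)
      then show ?case using none by (metis add_Suc_right le_add1)
    qed (simp add: assms)
    moreover have "x [^] (l + k) \<in> I"
      using assms(2) x I_l_closed by (simp add: nat_pow_mult[symmetric])
    ultimately show False by blast
  qed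
  then show thesis using that by blast
qed

lemma (in ideal) nat_pow_add_mem:
  assumes u: "u \<in> carrier R" and j: "j \<in> I"
  shows "\<exists>k\<in>I. (u \<oplus> j) [^] (n::nat) = u [^] n \<oplus> k"
proof (induction n)
  case 0
  show ?case by (intro bexI[of _ \<zero>]) simp_all
next
  case (Suc n)
  then obtain k where k: "k \<in> I" "(u \<oplus> j) [^] n = u [^] n \<oplus> k" by blast
  have c: "j \<in> carrier R" "k \<in> carrier R" "u [^] n \<in> carrier R" using u j k Icarr by auto
  have "(u \<oplus> j) [^] Suc n = (u [^] n \<oplus> k) \<otimes> (u \<oplus> j)" by (simp only: nat_pow_Suc k(2))
  also have "\<dots> = u [^] Suc n \<oplus> (u [^] n \<otimes> j \<oplus> k \<otimes> u \<oplus> k \<otimes> j)"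
    using c u by (simp add: l_distr r_distr a_ac)
  finally have "(u \<oplus> j) [^] Suc n = u [^] Suc n \<oplus> (u [^] n \<otimes> j \<oplus> k \<otimes> u \<oplus> k \<otimes> j)" .
  moreover have "u [^] n \<otimes> j \<oplus> k \<otimes> u \<oplus> k \<otimes> j \<in> I"
    using c u j k(1) by (simp add: I_l_closed I_r_closed)
  ultimately show ?case by blast
qed

lemma power_less_imp_exp_less:
  fixes a :: nat
  assumes "a ^ m < a ^ n" "0 < n"
  shows "m < n"
  using assms nat_power_less_imp_less[of a m n] by (cases "a = 0") (simp_all add: power_0_left)

section \<open>Finite ideals with quasi-inverses\<close>

text \<open>Differences of elements of \<open>T\<close> are units modulo \<open>p\<close>. If \<open>R\<close> contains a ring \<open>D\<close> with \<open>D / p D\<close> a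
  field, a set of representatives of the residue classes is such a \<open>T\<close>, and \<open>card T\<close> is the number of
  elements of that field.\<close>

locale quasi_regular_ideal = cring R + ideal N R for N and R (structure) +
  fixes p :: nat and T :: "'a set"
  assumes fin_N: "finite N"
    and quasi_inverse: "x \<in> N \<Longrightarrow> \<exists>y\<in>N. (\<one> \<oplus> x) \<otimes> (\<one> \<oplus> y) = \<one>"
    and prime_p: "Factorial_Ring.prime p"
    and T_carrier: "T \<subseteq> carrier R"
    and T_separated: "\<lbrakk>s \<in> T; t \<in> T; s \<noteq> t\<rbrakk>
      \<Longrightarrow> \<exists>e\<in>carrier R. \<exists>v\<in>carrier R. e \<otimes> (s \<ominus> t) = \<one> \<oplus> ([p] \<cdot> \<one>) \<otimes> v"
begin

definition p_one :: 'a where "p_one = [p] \<cdot> \<one>"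

definition adj :: "'a monoid" where "adj = adjoint_group (R\<lparr>carrier := N\<rparr>)"

definition add_group :: "'a set \<Rightarrow> ('a, 'b) monoid_scheme" where
  "add_group I = (add_monoid R)\<lparr>carrier := I\<rparr>"

lemma p_one_carrier [simp]: "p_one \<in> carrier R"
  by (simp add: p_one_def)

lemma add_pow_p: "x \<in> carrier R \<Longrightarrow> [p] \<cdot> x = p_one \<otimes> x"
  by (simp add: p_one_def add_pow_ldistr)

text \<open>As \<open>N\<close> is finite, \<open>x ^ i = x ^ (i + d)\<close> for some \<open>i, d > 0\<close>; in \<open>x ^ i (1 - x ^ d) = 0\<close> the second factor is a
  unit.\<close>

lemma nilpotent:
  assumes x: "x \<in> N"
  obtains k :: nat where "x [^] k = \<zero>"
proof -
  have xc: "x \<in> carrier R" using x by (rule Icarr)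
  have pow: "x [^] Suc k \<in> N" for k
    using x xc I_l_closed by simp
  have "\<not> inj (\<lambda>k. x [^] Suc k)"
    using finite_subset[OF _ fin_N, of "range (\<lambda>k. x [^] Suc k)"] pow finite_imageD by blast
  then obtain i j where ij: "i < j" "x [^] Suc i = x [^] Suc j"
    by (metis injI linorder_neqE_nat)
  define d where "d = j - Suc i"
  define z where "z = x [^] Suc i"
  define w where "w = \<ominus> (x [^] Suc d)"
  have zc: "z \<in> carrier R" and wN: "w \<in> N" and wc: "w \<in> carrier R"
    using pow[of d] xc Icarr by (auto simp: z_def w_def)
  have "z \<otimes> x [^] Suc d = x [^] (Suc i + Suc d)"
    unfolding z_def using xc by (simp only: nat_pow_mult)
  also have "Suc i + Suc d = Suc j" using ij(1) by (simp add: d_def)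
  finally have "z \<otimes> x [^] Suc d = z" using ij(2) by (simp only: z_def)
  then have "z \<otimes> (\<one> \<oplus> w) = \<zero>"
    using zc wc xc by (simp add: w_def r_distr r_minus r_neg del: nat_pow_Suc)
  moreover obtain y where y: "y \<in> N" "(\<one> \<oplus> w) \<otimes> (\<one> \<oplus> y) = \<one>"
    using quasi_inverse[OF wN] by blast
  have "z = z \<otimes> (\<one> \<oplus> w) \<otimes> (\<one> \<oplus> y)"
    using y zc wc Icarr[OF y(1)] by (simp add: m_assoc)
  ultimately have "z = \<zero>" using Icarr[OF y(1)] by simp
  then show thesis using that[of "Suc i"] by (simp only: z_def)
qed

lemma comm_group_add_group:
  assumes "ideal I R" shows "comm_group (add_group I)"
proof -
  interpret I: ideal I R by fact
  show ?thesis
    unfolding add_group_def by (rule comm_group.subgroup_imp_comm_group[OF a_comm_group I.a_subgroup])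
qed

lemma
  shows add_group_carrier: "carrier (add_group I) = I"
    and add_group_one: "\<one>\<^bsub>add_group I\<^esub> = \<zero>"
    and pow_add_group: "x [^]\<^bsub>add_group I\<^esub> (n::nat) = [n] \<cdot> x"
  by (simp_all add: add_group_def add_pow_def nat_pow_def)

lemma
  shows adj_carrier: "carrier adj = N"
    and adj_mult: "x \<otimes>\<^bsub>adj\<^esub> y = x \<oplus> y \<oplus> x \<otimes> y"
    and adj_one: "\<one>\<^bsub>adj\<^esub> = \<zero>"
  by (simp_all add: adj_def adjoint_group_def)

lemma adj_mult_closed: "\<lbrakk>ideal I R; x \<in> I; y \<in> I\<rbrakk> \<Longrightarrow> x \<otimes>\<^bsub>adj\<^esub> y \<in> I"
  by (simp add: adj_mult additive_subgroup.a_closed ideal.I_r_closed ideal.Icarr ideal.axioms)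

lemma one_plus_adj_mult:
  "\<lbrakk>x \<in> carrier R; y \<in> carrier R\<rbrakk> \<Longrightarrow> \<one> \<oplus> x \<otimes>\<^bsub>adj\<^esub> y = (\<one> \<oplus> x) \<otimes> (\<one> \<oplus> y)"
  by (simp add: adj_mult l_distr r_distr a_ac)

lemma comm_group_adj: "comm_group adj"
proof (rule groupI[THEN group.group_comm_groupI])
  show "x \<otimes>\<^bsub>adj\<^esub> y \<in> carrier adj" if "x \<in> carrier adj" "y \<in> carrier adj" for x y
    using that adj_mult_closed[OF ideal_axioms] by (simp add: adj_carrier)
  show "\<one>\<^bsub>adj\<^esub> \<in> carrier adj" by (simp add: adj_carrier adj_one)
  show "x \<otimes>\<^bsub>adj\<^esub> y \<otimes>\<^bsub>adj\<^esub> z = x \<otimes>\<^bsub>adj\<^esub> (y \<otimes>\<^bsub>adj\<^esub> z)"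
    if "x \<in> carrier adj" "y \<in> carrier adj" "z \<in> carrier adj" for x y z
    using that Icarr by (simp add: adj_carrier adj_mult l_distr r_distr a_ac m_assoc)
  show "\<one>\<^bsub>adj\<^esub> \<otimes>\<^bsub>adj\<^esub> x = x" if "x \<in> carrier adj" for x
    using that Icarr by (simp add: adj_carrier adj_mult adj_one)
  show "\<exists>y\<in>carrier adj. y \<otimes>\<^bsub>adj\<^esub> x = \<one>\<^bsub>adj\<^esub>" if x: "x \<in> carrier adj" for x
  proof -
    obtain y where y: "y \<in> N" "(\<one> \<oplus> x) \<otimes> (\<one> \<oplus> y) = \<one>"
      using quasi_inverse x by (auto simp: adj_carrier)
    have c: "x \<in> carrier R" "y \<in> carrier R" using x y Icarr by (auto simp: adj_carrier)
    have "\<one> \<oplus> y \<otimes>\<^bsub>adj\<^esub> x = \<one>"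
      using c y(2) by (simp add: one_plus_adj_mult m_comm)
    moreover have "y \<otimes>\<^bsub>adj\<^esub> x \<in> carrier R" using c by (simp add: adj_mult)
    ultimately have "y \<otimes>\<^bsub>adj\<^esub> x = \<zero>" by (simp only: add.l_cancel_one one_closed)
    then show ?thesis using y(1) by (auto simp: adj_carrier adj_one)
  qed
  show "x \<otimes>\<^bsub>adj\<^esub> y = y \<otimes>\<^bsub>adj\<^esub> x" if "x \<in> carrier adj" "y \<in> carrier adj" for x y
    using that Icarr by (simp add: adj_carrier adj_mult a_comm m_comm)
qed

lemma adj_pow_closed:
  assumes "ideal I R" "x \<in> I" shows "x [^]\<^bsub>adj\<^esub> (n::nat) \<in> I"
proof -
  interpret I: ideal I R by fact
  have "\<one>\<^bsub>adj\<^esub> \<in> I" by (simp add: adj_one)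
  then show ?thesis
    using assms adj_mult_closed by (induction n) (simp_all add: nat_pow_def)
qed

lemma one_plus_adj_pow:
  assumes x: "x \<in> N" shows "\<one> \<oplus> x [^]\<^bsub>adj\<^esub> (n::nat) = (\<one> \<oplus> x) [^] n"
proof (induction n)
  case 0
  then show ?case by (simp add: adj_one nat_pow_def)
next
  case (Suc n)
  have "x [^]\<^bsub>adj\<^esub> Suc n = x [^]\<^bsub>adj\<^esub> n \<otimes>\<^bsub>adj\<^esub> x" by (simp add: nat_pow_def)
  then show ?case
    using Suc x Icarr adj_pow_closed[OF ideal_axioms x, of n] by (simp add: one_plus_adj_mult)
qed

text \<open>One step of linear independence over the residue field: if \<open>(s - t) z \<in> K\<close> for different \<open>s, t \<in> T\<close>, then
  multiplying by an inverse of \<open>s - t\<close> modulo \<open>p\<close> gives \<open>z \<in> K\<close>. The set \<open>T \<times> K\<close> therefore embeds in every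
  ideal that contains \<open>K\<close> and \<open>z\<close>.\<close>

lemma inj_on_residue_combination:
  assumes K: "ideal K R" and z: "z \<in> carrier R" "z \<notin> K" and pz: "p_one \<otimes> z \<in> K"
  shows "inj_on (\<lambda>(t, u). t \<otimes> z \<oplus> u) (T \<times> K)"
proof (rule inj_onI, clarify)
  interpret K: ideal K R by fact
  fix s u t v assume s: "s \<in> T" "t \<in> T" and u: "u \<in> K" "v \<in> K"
    and e: "s \<otimes> z \<oplus> u = t \<otimes> z \<oplus> v"
  have c: "s \<in> carrier R" "t \<in> carrier R" "u \<in> carrier R" "v \<in> carrier R"
    using s u T_carrier K.a_subset by auto
  have "(s \<ominus> t) \<otimes> z = v \<ominus> u"
  proof -
    have "(s \<ominus> t) \<otimes> z = (s \<otimes> z \<oplus> u) \<ominus> u \<ominus> t \<otimes> z" using c z(1) by algebra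
    also have "\<dots> = v \<ominus> u" unfolding e using c z(1) by algebra
    finally show ?thesis .
  qed
  then have K: "(s \<ominus> t) \<otimes> z \<in> K" using u by (simp add: a_minus_def)
  have "s = t"
  proof (rule ccontr)
    assume "s \<noteq> t"
    then obtain f w where f: "f \<in> carrier R" "w \<in> carrier R" "f \<otimes> (s \<ominus> t) = \<one> \<oplus> p_one \<otimes> w"
      using T_separated s unfolding p_one_def by blast
    have "f \<otimes> ((s \<ominus> t) \<otimes> z) = (f \<otimes> (s \<ominus> t)) \<otimes> z" using c z(1) f(1) by algebra
    also have "\<dots> = z \<oplus> w \<otimes> (p_one \<otimes> z)" unfolding f(3) using z(1) f(1,2) p_one_carrier by algebra
    finally have "z \<oplus> w \<otimes> (p_one \<otimes> z) \<in> K" using K.I_l_closed[OF K f(1)] by simp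
    moreover have "w \<otimes> (p_one \<otimes> z) \<in> K" using K.I_l_closed[OF pz f(2)] .
    ultimately have "(z \<oplus> w \<otimes> (p_one \<otimes> z)) \<ominus> w \<otimes> (p_one \<otimes> z) \<in> K" by (simp add: a_minus_def)
    moreover have "(z \<oplus> w \<otimes> (p_one \<otimes> z)) \<ominus> w \<otimes> (p_one \<otimes> z) = z" using z(1) f(2) p_one_carrier by algebra
    ultimately show False using z(2) by simp
  qed
  then show "s = t \<and> u = v" using e c z(1) by simp
qed

text \<open>A count of the span of \<open>x ^ (a + 1), \<dots>, x ^ m\<close> modulo \<open>J\<close> without linear combinations. The colon ideals
  \<open>{y \<in> S. x ^ d y \<in> J}\<close> grow with \<open>d\<close>, starting from \<open>J\<close>. The element \<open>x ^ (m - d)\<close> is not in the \<open>d\<close>-th of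
  them, but it is in the next one and \<open>p\<close> times it is in the \<open>d\<close>-th, so each step multiplies the size by at
  least \<open>card T\<close>.\<close>

lemma card_colon_power:
  assumes J: "ideal J R" and S: "ideal S R" and fin: "finite S" and JS: "J \<subseteq> S"
    and x: "x \<in> carrier R" and m: "x [^] m \<notin> J" "x [^] Suc m \<in> J" "p_one \<otimes> x [^] m \<in> J"
    and xS: "\<And>j. \<lbrakk>a < j; j \<le> m\<rbrakk> \<Longrightarrow> x [^] j \<in> S"
    and d: "a + d \<le> (m::nat)"
  shows "card T ^ d * card J \<le> card {y \<in> S. x [^] d \<otimes> y \<in> J}"
  using d
proof (induction d)
  case 0
  interpret S: ideal S R by fact
  have "{y \<in> S. x [^] (0::nat) \<otimes> y \<in> J} = J" using JS S.a_subset by auto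
  then show ?case by simp
next
  case (Suc d)
  interpret J: ideal J R by fact
  interpret S: ideal S R by fact
  let ?K = "\<lambda>d::nat. {y \<in> S. x [^] d \<otimes> y \<in> J}"
  have xd: "x [^] d \<in> carrier R" for d :: nat using x by simp
  have K: "ideal (?K d) R"
  proof (rule idealI)
    show "subgroup (?K d) (add_monoid R)"
    proof (rule add.subgroupI)
      show "?K d \<subseteq> carrier R" using S.a_subset by auto
      show "?K d \<noteq> {}" using xd[of d] by (auto intro!: exI[of _ \<zero>])
    next
      fix y assume "y \<in> ?K d"
      then show "\<ominus> y \<in> ?K d" using xd[of d] S.a_subset by (auto simp: r_minus)
    next
      fix y z assume "y \<in> ?K d" "z \<in> ?K d"
      then show "y \<oplus> z \<in> ?K d" using xd[of d] S.a_subset by (auto simp: r_distr subsetD)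
    qed
  next
    fix y z assume y: "y \<in> ?K d" and z: "z \<in> carrier R"
    have "x [^] d \<otimes> (z \<otimes> y) = z \<otimes> (x [^] d \<otimes> y)" "y \<otimes> z = z \<otimes> y"
      using y z xd[of d] S.a_subset by (auto simp: m_ac subsetD)
    then show "z \<otimes> y \<in> ?K d" "y \<otimes> z \<in> ?K d"
      using y z S.I_l_closed J.I_l_closed by simp_all
  qed (rule ring_axioms)
  define z where "z = x [^] (m - d)"
  have zS: "z \<in> S" unfolding z_def using Suc.prems by (intro xS) auto
  have zc: "z \<in> carrier R" using x by (simp add: z_def)
  have dz: "x [^] d \<otimes> z = x [^] m" "x [^] Suc d \<otimes> z = x [^] Suc m"
    unfolding z_def using x Suc.prems by (simp_all only: nat_pow_mult) simp_all
  have zK: "z \<notin> ?K d" using m(1) dz(1) by simp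
  have "x [^] d \<otimes> (p_one \<otimes> z) = p_one \<otimes> x [^] m"
    unfolding dz(1)[symmetric] using xd[of d] zc by (simp add: m_lcomm)
  then have pz: "p_one \<otimes> z \<in> ?K d" using m(3) zS S.I_l_closed by simp
  let ?f = "\<lambda>(t, u). t \<otimes> z \<oplus> u"
  have "card (T \<times> ?K d) \<le> card (?K (Suc d))"
  proof (rule card_inj_on_le)
    show "inj_on ?f (T \<times> ?K d)" by (rule inj_on_residue_combination[OF K zc zK pz])
    show "finite (?K (Suc d))" using fin by simp
    show "?f ` (T \<times> ?K d) \<subseteq> ?K (Suc d)"
    proof clarify
      fix t u assume t: "t \<in> T" and u: "u \<in> S" "x [^] d \<otimes> u \<in> J"
      have c: "t \<in> carrier R" "u \<in> carrier R" using t u T_carrier S.a_subset by auto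
      have "x [^] Suc d \<otimes> (t \<otimes> z \<oplus> u) = t \<otimes> (x [^] Suc d \<otimes> z) \<oplus> x \<otimes> (x [^] d \<otimes> u)"
        using c zc x xd[of d] by (simp add: r_distr m_ac)
      also have "\<dots> \<in> J"
        unfolding dz(2) using m(2) u(2) c x J.I_l_closed by blast
      finally have "x [^] Suc d \<otimes> (t \<otimes> z \<oplus> u) \<in> J" .
      moreover have "t \<otimes> z \<oplus> u \<in> S" using zS u(1) c S.I_l_closed by blast
      ultimately show "t \<otimes> z \<oplus> u \<in> S \<and> x [^] Suc d \<otimes> (t \<otimes> z \<oplus> u) \<in> J" by blast
    qed
  qed
  then have "card T * card (?K d) \<le> card (?K (Suc d))" by (simp add: card_cartesian_product)
  moreover have "card T * (card T ^ d * card J) \<le> card T * card (?K d)"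
    using Suc by (intro mult_le_mono2) simp
  ultimately show ?case by (simp only: power_Suc mult.assoc)
qed

corollary card_ideal_ge_power:
  assumes J: "ideal J R" and S: "ideal S R" and fin: "finite S" and JS: "J \<subseteq> S"
    and x: "x \<in> carrier R" and m: "x [^] m \<notin> J" "x [^] Suc m \<in> J" "p_one \<otimes> x [^] m \<in> J"
    and xS: "\<And>j. \<lbrakk>a < j; j \<le> m\<rbrakk> \<Longrightarrow> x [^] j \<in> S"
    and d: "a + d \<le> (m::nat)"
  shows "card T ^ d * card J \<le> card S"
  by (rule order_trans[OF card_colon_power[OF assms] card_mono[OF fin]]) auto

lemma one_plus_cancel:
  "\<lbrakk>\<one> \<oplus> x = \<one> \<oplus> y; x \<in> carrier R; y \<in> carrier R\<rbrakk> \<Longrightarrow> x = y"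
  using add.l_cancel[of \<one> x y] by simp

text \<open>If \<open>card T = p ^ \<lambda>\<close>, this says that the rank of the additive group \<open>N\<close> is less than \<open>\<lambda> (p - 1)\<close>.\<close>

definition small_torsion :: bool where
  "small_torsion \<longleftrightarrow> card {y \<in> N. p_one \<otimes> y = \<zero>} < card T ^ (p - 1)"

lemma nth_powers_add_group:
  assumes "ideal I R" shows "nth_powers (add_group I) p = (\<otimes>) p_one ` I"
  using ideal.Icarr[OF assms] unfolding nth_powers_def pow_add_group add_group_carrier
  by (intro image_cong) (simp_all add: add_pow_p)

text \<open>In other words \<open>I / p I\<close> and the \<open>p\<close>-torsion of \<open>I\<close> have the same size.\<close>

lemma card_ideal_eq:
  assumes I: "ideal I R" and fin: "finite I"
  shows "card I = card {y \<in> I. p_one \<otimes> y = \<zero>} * card ((\<otimes>) p_one ` I)"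
proof -
  interpret A: comm_group "add_group I" by (rule comm_group_add_group[OF I])
  have "{y \<in> I. [p] \<cdot> y = \<zero>} = {y \<in> I. p_one \<otimes> y = \<zero>}"
    using ideal.Icarr[OF I] by (auto simp: add_pow_p)
  then show ?thesis
    using A.card_vimage_pow[of p UNIV] fin
    by (simp add: pow_add_group add_group_carrier add_group_one nth_powers_add_group[OF I])
qed

lemma card_ideal_pos:
  assumes "ideal I R" "finite I" shows "card I > 0"
  using assms additive_subgroup.zero_closed[OF ideal.axioms(1)] by (auto simp: card_gt_0_iff)

text \<open>Otherwise \<open>x, \<dots>, x ^ m\<close> are independent modulo \<open>p I\<close> for some \<open>m \<ge> p - 1\<close>, and \<open>I / p I\<close> has at least
  \<open>card T ^ (p - 1)\<close> elements, more than there is \<open>p\<close>-torsion in \<open>N\<close>.\<close>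

lemma pow_mem_p_mult:
  assumes small_torsion: small_torsion and I: "ideal I R" and IN: "I \<subseteq> N" and x: "x \<in> I"
  shows "x [^] (p - 1) \<in> (\<otimes>) p_one ` I"
proof (rule ccontr)
  assume notin: "x [^] (p - 1) \<notin> (\<otimes>) p_one ` I"
  interpret I: ideal I R by fact
  let ?J = "(\<otimes>) p_one ` I"
  have J: "ideal ?J R" by (rule ideal_image_mult[OF I p_one_carrier])
  interpret J: ideal ?J R by (rule J)
  have finI: "finite I" using IN fin_N finite_subset by blast
  have xc: "x \<in> carrier R" using x by (rule I.Icarr)
  obtain k :: nat where "x [^] k = \<zero>" using nilpotent x IN by blast
  then have "x [^] k \<in> ?J" by simp
  then obtain m where m: "p - 1 \<le> m" "x [^] m \<notin> ?J" "x [^] Suc m \<in> ?J"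
    using J.last_power_not_mem[OF xc _ notin] by blast
  have p1: "1 \<le> p - 1" using prime_gt_1_nat[OF prime_p] by simp
  have xI: "x [^] j \<in> I" if "0 < j" for j :: nat
    using that x xc by (cases j) (simp_all add: I.I_l_closed)
  have "card T ^ m * card ?J \<le> card I"
  proof (rule card_ideal_ge_power[OF J I finI _ xc m(2,3)])
    show "?J \<subseteq> I" using I.I_l_closed by auto
    show "p_one \<otimes> x [^] m \<in> ?J" using xI[of m] m(1) p1 by simp
    show "x [^] j \<in> I" if "0 < j" for j :: nat using that by (rule xI)
  qed simp_all
  also have "card I = card {y \<in> I. p_one \<otimes> y = \<zero>} * card ?J" by (rule card_ideal_eq[OF I finI])
  finally have "card T ^ m \<le> card {y \<in> I. p_one \<otimes> y = \<zero>}"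
    using card_ideal_pos[OF J] finI by simp
  also have "\<dots> \<le> card {y \<in> N. p_one \<otimes> y = \<zero>}"
    using IN fin_N by (intro card_mono) auto
  also have "\<dots> < card T ^ (p - 1)" using small_torsion by (simp add: small_torsion_def)
  finally have lt: "card T ^ m < card T ^ (p - 1)" .
  have "m < p - 1" using p1 by (intro power_less_imp_exp_less[OF lt]) simp
  then show False using m(1) by simp
qed

text \<open>The expansion of \<open>(1 + x) ^ p\<close>, read in the adjoint group where \<open>1 + x\<close> is represented by \<open>x\<close>.\<close>

lemma adj_pow_p:
  assumes x: "x \<in> N"
  obtains t where "t \<in> carrier R"
    "x [^]\<^bsub>adj\<^esub> p = (p_one \<otimes> x \<oplus> p_one \<otimes> (x \<otimes> x \<otimes> t)) \<oplus> x [^] p"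
proof -
  have xc: "x \<in> carrier R" using x by (rule Icarr)
  obtain t where t: "t \<in> carrier R"
    "(\<one> \<oplus> x) [^] p = \<one> \<oplus> (p_one \<otimes> x \<oplus> p_one \<otimes> (x \<otimes> x \<otimes> t)) \<oplus> x [^] p"
    using one_plus_pow_prime[OF prime_p xc] unfolding p_one_def by blast
  have c: "x [^]\<^bsub>adj\<^esub> p \<in> carrier R"
    using adj_pow_closed[OF ideal_axioms x] by (rule Icarr)
  have "\<one> \<oplus> x [^]\<^bsub>adj\<^esub> p = \<one> \<oplus> ((p_one \<otimes> x \<oplus> p_one \<otimes> (x \<otimes> x \<otimes> t)) \<oplus> x [^] p)"
    using xc t by (simp add: one_plus_adj_pow[OF x] a_assoc)
  then have "x [^]\<^bsub>adj\<^esub> p = (p_one \<otimes> x \<oplus> p_one \<otimes> (x \<otimes> x \<otimes> t)) \<oplus> x [^] p"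
    by (rule one_plus_cancel) (use c xc t(1) in simp_all)
  then show thesis using that t(1) by blast
qed

text \<open>Since \<open>x ^ (p - 1) = p a\<close> with \<open>a \<in> I\<close>, the term \<open>x ^ p = p (x a)\<close> joins the other multiples of \<open>p x\<close>.\<close>

lemma adj_pow_p_small:
  assumes small_torsion: small_torsion and I: "ideal I R" and IN: "I \<subseteq> N" and x: "x \<in> I"
  obtains w where "w \<in> I" "x [^]\<^bsub>adj\<^esub> p = p_one \<otimes> x \<oplus> p_one \<otimes> (x \<otimes> w)"
proof -
  interpret I: ideal I R by fact
  have xc: "x \<in> carrier R" using x by (rule I.Icarr)
  obtain t where t: "t \<in> carrier R"
    "x [^]\<^bsub>adj\<^esub> p = (p_one \<otimes> x \<oplus> p_one \<otimes> (x \<otimes> x \<otimes> t)) \<oplus> x [^] p"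
    using adj_pow_p x IN by blast
  obtain a where a: "a \<in> I" "x [^] (p - 1) = p_one \<otimes> a"
    using pow_mem_p_mult[OF assms] by blast
  have ac: "a \<in> carrier R" using a(1) by (rule I.Icarr)
  have "p = Suc (p - 1)" using prime_gt_0_nat[OF prime_p] by simp
  then have "x [^] p = x [^] (p - 1) \<otimes> x" by (metis nat_pow_Suc)
  also have "\<dots> = p_one \<otimes> (x \<otimes> a)" unfolding a(2) using ac xc by (simp add: m_ac)
  finally have xp: "x [^] p = p_one \<otimes> (x \<otimes> a)" .
  have "x [^]\<^bsub>adj\<^esub> p = p_one \<otimes> x \<oplus> p_one \<otimes> (x \<otimes> (x \<otimes> t \<oplus> a))"
    unfolding t(2) xp using xc ac t(1) by (simp add: r_distr a_assoc m_assoc)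
  moreover have "x \<otimes> t \<oplus> a \<in> I" using x t(1) a(1) by (simp add: I.I_r_closed)
  ultimately show thesis using that by blast
qed

text \<open>The form of Nakayama's lemma that the induction below needs: as \<open>x\<close> is nilpotent, \<open>x I = I\<close> forces
  \<open>I = 0\<close>. Principal multiples \<open>x I\<close> suffice, so products of ideals do not occur.\<close>

lemma image_mult_eq_imp_zero:
  assumes I: "ideal I R" and x: "x \<in> N" and e: "(\<otimes>) x ` I = I"
  shows "I = {\<zero>}"
proof -
  interpret I: ideal I R by fact
  have xc: "x \<in> carrier R" using x by (rule Icarr)
  obtain k :: nat where k: "x [^] k = \<zero>" using nilpotent x by blast
  have "(\<otimes>) (x [^] n) ` I = I" for n :: nat
  proof (induction n)
    case 0
    show ?case using I.Icarr by (auto simp: image_iff)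
  next
    case (Suc n)
    have "(\<otimes>) (x [^] Suc n) ` I = (\<otimes>) (x [^] n) ` ((\<otimes>) x ` I)"
      unfolding image_image using xc I.Icarr by (intro image_cong) (simp_all add: m_assoc)
    then show ?case using e Suc by simp
  qed
  from this[of k] have "(\<otimes>) \<zero> ` I = I" using k by simp
  moreover have "(\<otimes>) \<zero> ` I = (\<lambda>_. \<zero>) ` I" using I.Icarr by (intro image_cong) simp_all
  moreover have "(\<lambda>_. \<zero>) ` I = {\<zero>}" using I.zero_closed by blast
  ultimately show ?thesis by simp
qed

text \<open>Successive approximation: \<open>1 + p x\<close> differs from \<open>(1 + x) ^ p\<close> by a factor in \<open>1 + p (x I)\<close>, which is a
  \<open>p\<close>-th power by induction since \<open>x I\<close> is smaller than \<open>I\<close> unless \<open>I = 0\<close>.\<close>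

lemma p_mult_subset_adj_pow:
  assumes small_torsion: small_torsion and "ideal I R" and "I \<subseteq> N"
  shows "(\<otimes>) p_one ` I \<subseteq> (\<lambda>x. x [^]\<^bsub>adj\<^esub> p) ` I"
  using assms(2-)
proof (induction "card I" arbitrary: I rule: less_induct)
  case less
  note I = less.prems(1) and IN = less.prems(2)
  interpret I: ideal I R by fact
  interpret G: comm_group adj by (rule comm_group_adj)
  show ?case
  proof clarify
    fix x assume x: "x \<in> I"
    have xN: "x \<in> N" and xc: "x \<in> carrier R" using x IN I.Icarr by auto
    let ?K = "(\<otimes>) x ` I"
    have K: "ideal ?K R" by (rule ideal_image_mult[OF I xc])
    have KI: "?K \<subseteq> I" using I.I_l_closed xc by auto
    show "p_one \<otimes> x \<in> (\<lambda>x. x [^]\<^bsub>adj\<^esub> p) ` I"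
    proof (cases "?K = I")
      case True
      then have "I = {\<zero>}" using image_mult_eq_imp_zero[OF I xN] by simp
      then have "p_one \<otimes> x = \<zero> [^]\<^bsub>adj\<^esub> p" "\<zero> \<in> I"
        using x G.nat_pow_one by (auto simp: adj_one)
      then show ?thesis by blast
    next
      case False
      have "finite I" using IN fin_N finite_subset by blast
      then have "card ?K < card I" using False KI by (intro psubset_card_mono) auto
      then have IH: "(\<otimes>) p_one ` ?K \<subseteq> (\<lambda>x. x [^]\<^bsub>adj\<^esub> p) ` ?K"
        using less.hyps K KI IN by blast
      obtain w where w: "w \<in> I" "x [^]\<^bsub>adj\<^esub> p = p_one \<otimes> x \<oplus> p_one \<otimes> (x \<otimes> w)"
        using adj_pow_p_small[OF small_torsion I IN x] .
      define v where "v = x [^]\<^bsub>adj\<^esub> p"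
      have vN: "v \<in> N" unfolding v_def by (rule adj_pow_closed[OF ideal_axioms xN])
      then obtain v' where v': "v' \<in> N" "(\<one> \<oplus> v) \<otimes> (\<one> \<oplus> v') = \<one>"
        using quasi_inverse by blast
      have c: "w \<in> carrier R" "v \<in> carrier R" "v' \<in> carrier R"
        using w(1) vN v'(1) Icarr I.Icarr by auto
      \<comment> \<open>\<open>1 + u\<close> is the factor with \<open>(1 + v) (1 + u) = 1 + p x\<close>, where \<open>1 + v = (1 + x) ^ p\<close>\<close>
      define u where "u = p_one \<otimes> (x \<otimes> (\<ominus> ((\<one> \<oplus> v') \<otimes> w)))"
      have uc: "u \<in> carrier R" using c xc by (simp add: u_def)
      have "\<ominus> ((\<one> \<oplus> v') \<otimes> w) \<in> I" using c w(1) by (simp add: I.I_l_closed)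
      then have "u \<in> (\<otimes>) p_one ` ?K" unfolding u_def by blast
      with IH have "u \<in> (\<lambda>x. x [^]\<^bsub>adj\<^esub> p) ` ?K" by (rule subsetD)
      then obtain z where z: "u = z [^]\<^bsub>adj\<^esub> p" "z \<in> ?K" by (rule imageE)
      define d where "d = p_one \<otimes> (x \<otimes> w)"
      have d: "d \<in> carrier R" using c xc by (simp add: d_def)
      have v: "v = p_one \<otimes> x \<oplus> d" unfolding v_def d_def by (rule w(2))
      have ud: "u = \<ominus> ((\<one> \<oplus> v') \<otimes> d)"
        unfolding u_def d_def using c xc p_one_carrier by algebra
      have "\<one> \<oplus> v \<otimes>\<^bsub>adj\<^esub> u = (\<one> \<oplus> v) \<otimes> (\<one> \<oplus> u)"
        using c uc by (simp add: one_plus_adj_mult)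
      also have "\<dots> = (\<one> \<oplus> v) \<ominus> ((\<one> \<oplus> v) \<otimes> (\<one> \<oplus> v')) \<otimes> d"
        unfolding ud using c d by algebra
      also have "\<dots> = \<one> \<oplus> v \<ominus> d"
        unfolding v'(2) using d by simp
      also have "\<dots> = \<one> \<oplus> p_one \<otimes> x"
        unfolding v using d xc p_one_carrier by algebra
      finally have "v \<otimes>\<^bsub>adj\<^esub> u = p_one \<otimes> x"
        by (rule one_plus_cancel) (use c uc xc in \<open>simp_all add: adj_mult\<close>)
      moreover have "(x \<otimes>\<^bsub>adj\<^esub> z) [^]\<^bsub>adj\<^esub> p = v \<otimes>\<^bsub>adj\<^esub> u"
        unfolding v_def z(1) using xN z(2) KI IN
        by (intro G.nat_pow_distrib) (auto simp only: adj_carrier)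
      moreover have "x \<otimes>\<^bsub>adj\<^esub> z \<in> I"
        using adj_mult_closed[OF I x] z(2) KI by blast
      ultimately show ?thesis by (intro image_eqI[of _ _ "x \<otimes>\<^bsub>adj\<^esub> z"]) simp_all
    qed
  qed
qed

lemma adj_pow_image_ideal:
  assumes small_torsion: small_torsion and I: "ideal I R" and IN: "I \<subseteq> N"
  shows "(\<lambda>x. x [^]\<^bsub>adj\<^esub> p) ` I = (\<otimes>) p_one ` I"
proof
  interpret I: ideal I R by fact
  show "(\<lambda>x. x [^]\<^bsub>adj\<^esub> p) ` I \<subseteq> (\<otimes>) p_one ` I"
  proof clarify
    fix x assume x: "x \<in> I"
    obtain w where w: "w \<in> I" "x [^]\<^bsub>adj\<^esub> p = p_one \<otimes> x \<oplus> p_one \<otimes> (x \<otimes> w)"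
      using adj_pow_p_small[OF small_torsion I IN x] .
    then have "x [^]\<^bsub>adj\<^esub> p = p_one \<otimes> (x \<oplus> x \<otimes> w)" "x \<oplus> x \<otimes> w \<in> I"
      using x I.Icarr by (simp_all add: r_distr I.I_l_closed)
    then show "x [^]\<^bsub>adj\<^esub> p \<in> (\<otimes>) p_one ` I" by blast
  qed
qed (rule p_mult_subset_adj_pow[OF assms])

text \<open>The set equality \<open>(1 + N) ^ (p ^ i) = 1 + p ^ i N\<close>. It is carried through the induction together with the
  fact that \<open>p ^ i N\<close> is an ideal, to which the case of \<open>p\<close>-th powers applies.\<close>

theorem nth_powers_adj_eq:
  assumes small_torsion: small_torsion
  shows "nth_powers adj (p ^ i) = nth_powers (add_group N) (p ^ i)"
proof -
  interpret G: comm_group adj by (rule comm_group_adj)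
  interpret A: comm_group "add_group N" by (rule comm_group_add_group[OF ideal_axioms])
  have "nth_powers adj (p ^ i) = nth_powers (add_group N) (p ^ i) \<and>
      ideal (nth_powers (add_group N) (p ^ i)) R \<and> nth_powers (add_group N) (p ^ i) \<subseteq> N"
  proof (induction i)
    case 0
    show ?case
      using G.nth_powers_1 A.nth_powers_1 ideal_axioms by (simp add: adj_carrier add_group_carrier)
  next
    case (Suc i)
    let ?I = "nth_powers (add_group N) (p ^ i)"
    have I: "ideal ?I R" and IN: "?I \<subseteq> N" using Suc by auto
    have 1: "nth_powers adj (p ^ Suc i) = (\<otimes>) p_one ` ?I"
      unfolding power_Suc2 G.nth_powers_mult using Suc adj_pow_image_ideal[OF small_torsion I IN] by simp
    have 2: "nth_powers (add_group N) (p ^ Suc i) = (\<otimes>) p_one ` ?I"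
      unfolding power_Suc2 A.nth_powers_mult pow_add_group
      using IN by (intro image_cong) (auto simp: add_pow_p Icarr)
    have "(\<otimes>) p_one ` ?I \<subseteq> N" using IN I_l_closed by auto
    then show ?case using 1 2 ideal_image_mult[OF I p_one_carrier] by simp
  qed
  then show ?thesis by blast
qed

text \<open>By the binomial expansion, \<open>B = {x. x ^ p \<in> p N}\<close> consists of elements for which \<open>(1 + x) ^ p \<in> 1 + p N\<close>; as
  the \<open>p\<close>-th power map of \<open>1 + N\<close> has a small kernel, \<open>B\<close> has fewer than \<open>card T ^ (p - 1)\<close> times the elements
  of \<open>p N\<close>. If \<open>B = N\<close>, this is the claim. Otherwise let \<open>x ^ m\<close> be the last power of some \<open>x \<notin> B\<close> outside
  \<open>p N\<close>, so \<open>m \<ge> p\<close>. The ideal generated by \<open>p N\<close> and the \<open>x ^ j\<close> with \<open>p j > m\<close> lies in \<open>B\<close>, and it contains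
  \<open>m - m div p \<ge> p - 1\<close> powers independent modulo \<open>p N\<close>, which is too many.\<close>

lemma small_torsion_if_adj_small:
  assumes less: "card {x \<in> N. x [^]\<^bsub>adj\<^esub> p = \<zero>} < card T ^ (p - 1)"
  shows small_torsion
proof -
  interpret G: comm_group adj by (rule comm_group_adj)
  let ?J = "(\<otimes>) p_one ` N"
  have J: "ideal ?J R" by (rule ideal_image_mult[OF ideal_axioms p_one_carrier])
  interpret J: ideal ?J R by (rule J)
  have JN: "?J \<subseteq> N" using I_l_closed by auto
  have finJ: "finite ?J" using fin_N by simp
  note Jpos = card_ideal_pos[OF J finJ]
  define B where "B = {x \<in> N. x [^] p \<in> ?J}"
  have B: "x [^]\<^bsub>adj\<^esub> p \<in> ?J" if "x \<in> B" for x
  proof -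
    have x: "x \<in> N" "x [^] p \<in> ?J" "x \<in> carrier R" using that Icarr by (auto simp: B_def)
    obtain t where t: "t \<in> carrier R"
      "x [^]\<^bsub>adj\<^esub> p = (p_one \<otimes> x \<oplus> p_one \<otimes> (x \<otimes> x \<otimes> t)) \<oplus> x [^] p" using adj_pow_p[OF x(1)] .
    have "x \<otimes> x \<otimes> t \<in> N" using x t(1) by (simp add: I_r_closed)
    then have "p_one \<otimes> x \<in> ?J" "p_one \<otimes> (x \<otimes> x \<otimes> t) \<in> ?J" using x(1) by blast+
    then show ?thesis unfolding t(2) using x(2) by (intro J.a_closed)
  qed
  have "card B \<le> card {x \<in> carrier adj. x [^]\<^bsub>adj\<^esub> p \<in> ?J}"
    using B fin_N by (intro card_mono) (auto simp: adj_carrier B_def)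
  also have "\<dots> = card {x \<in> N. x [^]\<^bsub>adj\<^esub> p = \<zero>} * card (?J \<inter> nth_powers adj p)"
    using G.card_vimage_pow[of p ?J] fin_N by (simp add: adj_carrier adj_one)
  also have "\<dots> \<le> card {x \<in> N. x [^]\<^bsub>adj\<^esub> p = \<zero>} * card ?J"
    using finJ by (intro mult_le_mono2 card_mono) auto
  also have "\<dots> < card T ^ (p - 1) * card ?J" using less Jpos by simp
  finally have cardB: "card B < card T ^ (p - 1) * card ?J" .
  have "B = N"
  proof (rule ccontr)
    assume "B \<noteq> N"
    then obtain x where x: "x \<in> N" "x [^] p \<notin> ?J" by (auto simp: B_def)
    have xc: "x \<in> carrier R" using x(1) by (rule Icarr)
    obtain k :: nat where "x [^] k = \<zero>" using nilpotent x(1) by blast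
    then have "x [^] k \<in> ?J" by simp
    then obtain m where m: "p \<le> m" "x [^] m \<notin> ?J" "x [^] Suc m \<in> ?J"
      using J.last_power_not_mem[OF xc _ x(2)] by blast
    define a where "a = m div p"
    define S where "S = PIdl (x [^] Suc a) <+>\<^bsub>R\<^esub> ?J"
    have Sx: "ideal (PIdl (x [^] Suc a)) R" using xc by (intro cgenideal_ideal) simp
    have S: "ideal S R" unfolding S_def by (rule add_ideals[OF Sx J])
    have xN: "x [^] Suc j \<in> N" for j using x(1) xc by (simp add: I_l_closed)
    have big: "x [^] (Suc a * p) \<in> ?J"
    proof -
      have "Suc m \<le> Suc a * p"
        using dividend_less_times_div[of p m] prime_gt_0_nat[OF prime_p]
        by (simp add: a_def mult.commute)
      then have "x [^] (Suc a * p) = x [^] (Suc a * p - Suc m) \<otimes> x [^] Suc m"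
        using xc by (simp only: nat_pow_mult le_add_diff_inverse2)
      then show ?thesis using J.I_l_closed[OF m(3)] xc by simp
    qed
    have "S \<subseteq> B"
    proof
      fix s assume "s \<in> S"
      then obtain r j where s: "r \<in> carrier R" "j \<in> ?J" "s = r \<otimes> x [^] Suc a \<oplus> j"
        unfolding S_def by (auto simp: set_add_def' cgenideal_def simp del: nat_pow_Suc)
      have rN: "r \<otimes> x [^] Suc a \<in> N" using I_l_closed[OF xN s(1)] .
      have sN: "s \<in> N" unfolding s(3) using rN s(2) JN by (intro a_closed) auto
      obtain k where k: "k \<in> ?J" "s [^] p = (r \<otimes> x [^] Suc a) [^] p \<oplus> k"
        using J.nat_pow_add_mem[OF Icarr[OF rN] s(2)] s(3) by blast
      have "(r \<otimes> x [^] Suc a) [^] p = r [^] p \<otimes> x [^] (Suc a * p)"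
        using s(1) xc by (simp only: nat_pow_distrib nat_pow_closed nat_pow_pow)
      moreover have "r [^] p \<otimes> x [^] (Suc a * p) \<in> ?J"
        using J.I_l_closed[OF big] s(1) by simp
      ultimately have "s [^] p \<in> ?J" unfolding k(2) using k(1) by (simp only: J.a_closed)
      then show "s \<in> B" using sN by (simp add: B_def)
    qed
    then have SN: "S \<subseteq> N" by (auto simp: B_def)
    have "card T ^ (m - a) * card ?J \<le> card S"
    proof (rule card_ideal_ge_power[OF J S _ _ xc m(2,3)])
      show "finite S" using SN fin_N finite_subset by blast
      show "?J \<subseteq> S"
      proof
        fix j assume j: "j \<in> ?J"
        have "\<zero> \<in> PIdl (x [^] Suc a)" using Sx additive_subgroup.zero_closed ideal.axioms(1) by blast
        moreover have "j = \<zero> \<oplus> j" using J.Icarr[OF j] by simp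
        ultimately show "j \<in> S" using j unfolding S_def set_add_def' by blast
      qed
      have "0 < m" using m(1) prime_gt_0_nat[OF prime_p] by simp
      then show "p_one \<otimes> x [^] m \<in> ?J" using xN[of "m - 1"] by simp
      show "x [^] j \<in> S" if "a < j" for j
      proof -
        have "x [^] j = x [^] (j - Suc a) \<otimes> x [^] Suc a"
          using that xc by (simp only: nat_pow_mult le_add_diff_inverse2 Suc_leI)
        then have "x [^] j \<in> PIdl (x [^] Suc a)" using xc unfolding cgenideal_def by blast
        moreover have "x [^] j = x [^] j \<oplus> \<zero>" using xc by simp
        ultimately show ?thesis using J.zero_closed unfolding S_def set_add_def' by blast
      qed
      show "a + (m - a) \<le> m" by (simp add: a_def)
    qed
    also have "card S \<le> card B" using \<open>S \<subseteq> B\<close> fin_N by (intro card_mono) (auto simp: B_def)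
    also note cardB
    finally have lt: "card T ^ (m - a) < card T ^ (p - 1)" using Jpos by simp
    have "p - 1 \<le> m - a"
    proof -
      have "1 \<le> a" using m(1) prime_gt_0_nat[OF prime_p] by (simp add: a_def div_greater_zero_iff Suc_le_eq)
      then have "1 * (p - 1) \<le> a * (p - 1)" by (rule mult_le_mono1)
      also have "\<dots> = a * p - a" by (simp add: diff_mult_distrib2)
      also have "\<dots> \<le> m - a" by (simp add: a_def diff_le_mono)
      finally show ?thesis by simp
    qed
    moreover have "m - a < p - 1"
      using prime_gt_1_nat[OF prime_p] by (intro power_less_imp_exp_less[OF lt]) simp
    ultimately show False by simp
  qed
  then have "card {y \<in> N. p_one \<otimes> y = \<zero>} * card ?J < card T ^ (p - 1) * card ?J"
    using cardB card_ideal_eq[OF ideal_axioms fin_N] by simp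
  then show small_torsion unfolding small_torsion_def by simp
qed

theorem add_group_iso_adj:
  assumes T: "card T = p ^ l" and N: "card N = p ^ n"
    and small_grp: "small_group l p (add_group N) \<or> small_group l p adj"
  shows "add_group N \<cong> adj"
proof -
  have A: "comm_group (add_group N)" by (rule comm_group_add_group[OF ideal_axioms])
  have oA: "order (add_group N) = p ^ n" and oU: "order adj = p ^ n"
    using N by (simp_all add: order_def add_group_carrier adj_carrier)
  have "small_torsion"
    using small_grp
  proof
    assume "small_group l p (add_group N)"
    then have "card {x \<in> N. [p] \<cdot> x = \<zero>} < card T ^ (p - 1)"
      using card_torsion_less_if_small[OF prime_p A oA]
      by (simp add: add_group_carrier add_group_one pow_add_group T)
    moreover have "{x \<in> N. [p] \<cdot> x = \<zero>} = {x \<in> N. p_one \<otimes> x = \<zero>}"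
      using add_pow_p Icarr by auto
    ultimately show small_torsion by (simp add: small_torsion_def)
  next
    assume "small_group l p adj"
    then have "card {x \<in> N. x [^]\<^bsub>adj\<^esub> p = \<zero>} < card T ^ (p - 1)"
      using card_torsion_less_if_small[OF prime_p comm_group_adj oU]
      by (simp add: adj_carrier adj_one T)
    then show small_torsion by (rule small_torsion_if_adj_small)
  qed
  then show ?thesis
    using nth_powers_adj_eq
    by (intro p_groups_isomorphic_if_card_powers[OF prime_p A oA comm_group_adj oU]) simp
qed

end

section \<open>The residue field at p\<close>

lemma (in ring) card_dimension:
  assumes K: "subfield K R" and dim: "dimension n K E"
  shows "card E = card K ^ n"
  using dim
proof (induction n arbitrary: E)
  case 0
  then have "E = {\<zero>}" using dimension_zero[OF K] by blast
  then show ?case by simp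
next
  case (Suc n)
  then obtain v F where v: "v \<in> carrier R" "v \<notin> F" and F: "dimension n K F"
    and E: "E = line_extension K v F"
    using dimension_backwards[OF K] by blast
  note Fp = space_subgroup_props[OF K F]
  have Kc: "K \<subseteq> carrier R" by (rule subfieldE(3)[OF K])
  note Kr = subringE[OF subfieldE(1)[OF K]]
  let ?f = "\<lambda>(k, w). k \<otimes> v \<oplus> w"
  have "inj_on ?f (K \<times> F)"
  proof (rule inj_onI, clarify)
    fix k w l u assume k: "k \<in> K" "l \<in> K" and w: "w \<in> F" "u \<in> F"
      and e: "k \<otimes> v \<oplus> w = l \<otimes> v \<oplus> u"
    have c: "k \<in> carrier R" "l \<in> carrier R" "w \<in> carrier R" "u \<in> carrier R"
      using k w Kc Fp(1) by auto
    have "(k \<ominus> l) \<otimes> v = (k \<otimes> v \<oplus> w) \<ominus> w \<ominus> l \<otimes> v"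
      using c v(1) by algebra
    also have "\<dots> = u \<oplus> \<ominus> w"
      unfolding e using c v(1) by algebra
    finally have "(k \<ominus> l) \<otimes> v \<in> F" using Fp(3,4) w by simp
    moreover have "k \<ominus> l \<in> K" using Kr(5,7) k by (simp add: a_minus_def)
    ultimately have "k \<ominus> l = \<zero>" using Fp(6)[of "k \<ominus> l" v] v by blast
    then have "k = l" using c by simp
    then show "k = l \<and> w = u" using e c v(1) by simp
  qed
  moreover have "?f ` (K \<times> F) = E"
    unfolding E by (auto simp: line_extension_mem_iff, blast)
  ultimately have "card E = card (K \<times> F)" by (metis card_image)
  then show ?case using Suc.IH[OF F] by (simp add: card_cartesian_product)
qed

lemma (in ring) card_carrier_eq_dim:
  assumes K: "subfield K R" and fin: "finite (carrier R)"
  shows "card (carrier R) = card K ^ dim K (carrier R)"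
proof -
  obtain Us where Us: "set Us = carrier R" using finite_list[OF fin] by blast
  have "Span K Us = carrier R"
    using Span_base_incl[OF K, of Us] Span_in_carrier[OF subfieldE(3)[OF K], of Us] Us by blast
  then have "finite_dimension K (carrier R)"
    using Span_finite_dimension[OF K, of Us] Us by simp
  then show ?thesis
    using card_dimension[OF K finite_dimensionE[OF K]] by (simp only: over_def)
qed

text \<open>In a finite domain the injective multiplications are surjective. Besides the residue field itself, the
  image of the integers in it is treated this way, which makes it a subfield.\<close>

lemma (in domain) finite_subring_has_inverses:
  assumes K: "subring K R" and fin: "finite K" and a: "a \<in> K" "a \<noteq> \<zero>"
  obtains b where "b \<in> K" "a \<otimes> b = \<one>"
proof -
  note Kr = subringE[OF K]
  have "inj_on ((\<otimes>) a) K"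
  proof (rule inj_onI)
    fix x y assume "x \<in> K" "y \<in> K" "a \<otimes> x = a \<otimes> y"
    then show "x = y" using m_lcancel[of a x y] a Kr(1) by auto
  qed
  moreover have "(\<otimes>) a ` K \<subseteq> K" using a(1) Kr(6) by auto
  ultimately have "(\<otimes>) a ` K = K" using fin by (simp add: endo_inj_surj)
  then have "\<one> \<in> (\<otimes>) a ` K" using Kr(3) by simp
  then show thesis using that by (elim imageE) simp
qed

lemma (in domain) finite_domain_is_field:
  assumes "finite (carrier R)" shows "field R"
proof (rule cring_fieldI2)
  fix a assume a: "a \<in> carrier R" "a \<noteq> \<zero>"
  show "\<exists>b\<in>carrier R. a \<otimes> b = \<one>"
    using finite_subring_has_inverses[OF carrier_is_subring assms a] by blast
qed simp

lemma (in domain) finite_subring_is_subfield: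
  assumes K: "subring K R" and fin: "finite (carrier R)"
  shows "subfield K R"
proof -
  interpret field R by (rule finite_domain_is_field[OF fin])
  have finK: "finite K" using subringE(1)[OF K] fin finite_subset by blast
  show ?thesis
  proof (rule subfieldI'[OF K])
    fix a assume a: "a \<in> K - {\<zero>}"
    then obtain b where b: "b \<in> K" "a \<otimes> b = \<one>"
      using finite_subring_has_inverses[OF K finK] by blast
    have "a \<in> carrier R" "b \<in> carrier R" using a b subringE(1)[OF K] by auto
    then have "inv a = b" using b(2) by (metis comm_inv_char)
    then show "inv a \<in> K" using b(1) by simp
  qed
qed

lemma (in ring) subring_integer_image: "subring (integer_image R) R"
proof (rule subringI)
  show "integer_image R \<subseteq> carrier R"
    unfolding integer_image_def by (intro image_subsetI add.int_pow_closed one_closed)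
  have "\<one> = [(1::int)] \<cdot> \<one>" by simp
  then show "\<one> \<in> integer_image R" unfolding integer_image_def by (metis rangeI)
  fix h assume "h \<in> integer_image R"
  then obtain m :: int where m: "h = [m] \<cdot> \<one>" by (auto simp: integer_image_def)
  have "\<ominus> h = [(- m)] \<cdot> \<one>" unfolding m by (simp add: add.int_pow_neg)
  then show "\<ominus> h \<in> integer_image R" unfolding integer_image_def by blast
  fix k assume "k \<in> integer_image R"
  then obtain n :: int where n: "k = [n] \<cdot> \<one>" by (auto simp: integer_image_def)
  have "h \<oplus> k = [(m + n)] \<cdot> \<one>" unfolding m n by (simp add: add.int_pow_mult)
  then show "h \<oplus> k \<in> integer_image R" unfolding integer_image_def by blast
  have "h \<otimes> k = [(n * m)] \<cdot> \<one>"
    unfolding m n by (simp add: add_pow_ldistr_int add.int_pow_pow)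
  then show "h \<otimes> k \<in> integer_image R" unfolding integer_image_def by blast
qed

lemma (in ring) card_integer_image:
  assumes p: "Factorial_Ring.prime p" and "[p] \<cdot> \<one> = \<zero>" and "\<one> \<noteq> \<zero>"
  shows "card (integer_image R) = p"
proof -
  have p0: "int p > 0" using prime_gt_0_nat[OF p] by simp
  have "add.ord \<one> dvd p" using assms(2) by (simp flip: add.pow_eq_id)
  moreover have "add.ord \<one> \<noteq> 1" using assms(3) add.ord_eq_1[OF one_closed] by simp
  ultimately have o: "add.ord \<one> = p" using p by (metis prime_nat_iff)
  have eq: "[m] \<cdot> \<one> = [n] \<cdot> \<one> \<longleftrightarrow> int p dvd n - m" for m n :: int
    using add.int_pow_eq[OF one_closed, of m n] o by simp
  have "integer_image R = (\<lambda>n::int. [n] \<cdot> \<one>) ` {0..<int p}"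
  proof (intro equalityI subsetI)
    fix x assume "x \<in> integer_image R"
    then obtain n :: int where n: "x = [n] \<cdot> \<one>" by (auto simp: integer_image_def)
    have "[n] \<cdot> \<one> = [(n mod int p)] \<cdot> \<one>"
      unfolding eq by (simp add: mod_eq_dvd_iff[symmetric])
    moreover have "n mod int p \<in> {0..<int p}" using p0 by simp
    ultimately show "x \<in> (\<lambda>n::int. [n] \<cdot> \<one>) ` {0..<int p}" unfolding n by blast
  qed (auto simp: integer_image_def)
  moreover have "inj_on (\<lambda>n::int. [n] \<cdot> \<one>) {0..<int p}"
  proof (rule inj_onI)
    fix m n assume m: "m \<in> {0..<int p}" "n \<in> {0..<int p}" and "[m] \<cdot> \<one> = [n] \<cdot> \<one>"
    then have "n mod int p = m mod int p" unfolding eq by (simp only: mod_eq_dvd_iff)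
    then show "m = n" using m by simp
  qed
  ultimately have "card (integer_image R) = card {0..<int p}" by (simp only: card_image)
  then show ?thesis by simp
qed

lemma zero_FactRing: "\<zero>\<^bsub>R Quot I\<^esub> = I"
  by (simp add: FactRing_def)

lemma carrier_FactRing: "carrier (R Quot I) = (+>\<^bsub>R\<^esub>) I ` carrier R"
  unfolding FactRing_def A_RCOSETS_def' by auto

context cring
begin

context
  fixes p :: nat
  assumes prime: "Factorial_Ring.prime p"
    and primeideal: "primeideal (nat_ideal R p) R"
    and fin: "finite (carrier (R Quot (nat_ideal R p)))"
begin

lemma quot_nat_ideal_char: "[p] \<cdot>\<^bsub>R Quot (nat_ideal R p)\<^esub> \<one>\<^bsub>R Quot (nat_ideal R p)\<^esub> = \<zero>\<^bsub>R Quot (nat_ideal R p)\<^esub>"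
proof -
  let ?I = "nat_ideal R p" and ?F = "R Quot (nat_ideal R p)"
  interpret I: primeideal ?I R by (rule primeideal)
  interpret F: domain ?F by (rule I.quotient_is_domain)
  interpret h: ring_hom_cring R ?F "(+>) ?I" by (rule I.rcos_ring_hom_cring)
  have pow: "?I +> ([n] \<cdot> \<one>) = [n] \<cdot>\<^bsub>?F\<^esub> \<one>\<^bsub>?F\<^esub>" for n :: nat
    by (induction n) simp_all
  have "?I +> ([p] \<cdot> \<one>) = ?I"
    by (rule I.a_rcos_const) (simp add: nat_ideal_def cgenideal_self)
  then show ?thesis by (simp only: pow zero_FactRing)
qed

lemma card_residue_field:
  "card (carrier (R Quot (nat_ideal R p))) = p ^ residue_degree R p"
proof -
  let ?I = "nat_ideal R p" and ?F = "R Quot (nat_ideal R p)"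
  interpret F: domain ?F by (rule primeideal.quotient_is_domain[OF primeideal])
  have "subfield (integer_image ?F) ?F"
    by (rule F.finite_subring_is_subfield[OF F.subring_integer_image fin])
  moreover have "card (integer_image ?F) = p"
    by (rule F.card_integer_image[OF prime quot_nat_ideal_char]) simp
  ultimately show ?thesis
    using F.card_carrier_eq_dim[OF _ fin] by (simp add: residue_degree_def Let_def)
qed

text \<open>Two representatives of different classes have a difference that is nonzero, hence invertible, in the
  residue field.\<close>

lemma residue_system_exists:
  obtains T where "T \<subseteq> carrier R" "card T = p ^ residue_degree R p"
    "\<And>s t. \<lbrakk>s \<in> T; t \<in> T; s \<noteq> t\<rbrakk>
      \<Longrightarrow> \<exists>e\<in>carrier R. \<exists>v\<in>carrier R. e \<otimes> (s \<ominus> t) = \<one> \<oplus> ([p] \<cdot> \<one>) \<otimes> v"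
proof -
  let ?I = "nat_ideal R p" and ?F = "R Quot (nat_ideal R p)"
  interpret I: primeideal ?I R by (rule primeideal)
  interpret F: domain ?F by (rule I.quotient_is_domain)
  interpret FF: field ?F by (rule F.finite_domain_is_field[OF fin])
  interpret h: ring_hom_cring R ?F "(+>) ?I" by (rule I.rcos_ring_hom_cring)
  have surj: "carrier ?F = (+>) ?I ` carrier R"
    by (rule carrier_FactRing)
  obtain T where T: "T \<subseteq> carrier R" "inj_on ((+>) ?I) T" "carrier ?F = (+>) ?I ` T"
    using equalityD1[OF surj] unfolding subset_image_inj by (elim exE conjE)
  have bij: "bij_betw ((+>) ?I) T (carrier ?F)"
    unfolding bij_betw_def using T(2) T(3)[symmetric] by (rule conjI)
  have "card T = p ^ residue_degree R p"
    using bij_betw_same_card[OF bij] card_residue_field by simp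
  moreover have "\<exists>e\<in>carrier R. \<exists>v\<in>carrier R. e \<otimes> (s \<ominus> t) = \<one> \<oplus> ([p] \<cdot> \<one>) \<otimes> v"
    if st: "s \<in> T" "t \<in> T" "s \<noteq> t" for s t
  proof -
    have c: "s \<in> carrier R" "t \<in> carrier R" using st T(1) by auto
    define d where "d = s \<ominus> t"
    have d: "d \<in> carrier R" using c by (simp add: d_def)
    have "?I +> s \<noteq> ?I +> t" using st T(2) by (meson inj_onD)
    then have "d \<notin> ?I" unfolding d_def using quotient_eq_iff_same_a_r_cos[OF I.is_ideal c] by simp
    then have "?I +> d \<noteq> \<zero>\<^bsub>?F\<^esub>" using I.a_rcos_self[OF d] unfolding zero_FactRing by blast
    then have "?I +> d \<in> Units ?F" using FF.field_Units d by simp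
    then obtain E where E: "E \<in> carrier ?F" "E \<otimes>\<^bsub>?F\<^esub> (?I +> d) = \<one>\<^bsub>?F\<^esub>"
      by (auto simp: Units_def)
    then obtain e where e: "e \<in> carrier R" "E = ?I +> e" using surj by auto
    have "?I +> (e \<otimes> d) = ?I +> \<one>" using E(2) e d by simp
    then have "e \<otimes> d \<ominus> \<one> \<in> ?I"
      using quotient_eq_iff_same_a_r_cos[OF I.is_ideal] e(1) d by simp
    then obtain v where v: "v \<in> carrier R" "e \<otimes> d \<ominus> \<one> = v \<otimes> ([p] \<cdot> \<one>)"
      unfolding nat_ideal_def cgenideal_def by blast
    have "e \<otimes> d = \<one> \<oplus> (e \<otimes> d \<ominus> \<one>)" using e(1) d by algebra
    also have "\<dots> = \<one> \<oplus> ([p] \<cdot> \<one>) \<otimes> v" unfolding v(2) using v(1) by (simp add: m_comm)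
    finally show ?thesis using e(1) v(1) unfolding d_def by blast
  qed
  ultimately show thesis using that T(1) by blast
qed

end

end

section \<open>Adjoining the scalars to the ring\<close>

text \<open>The ring \<open>D \<oplus> N\<close>, in which \<open>(a, x)\<close> stands for \<open>a + x\<close>: the usual adjunction of a unity with \<open>D\<close> in place of
  the integers. Taking \<open>D\<close> turns \<open>D\<close>-submodules that are ideals of \<open>N\<close> into ordinary ideals.\<close>

definition unitization :: "('d, 'e) ring_scheme \<Rightarrow> ('d, 'n, 'm) module_scheme \<Rightarrow> ('d \<times> 'n) ring" where
  "unitization D N =
    \<lparr>carrier = carrier D \<times> carrier N,
     monoid.mult = (\<lambda>u v. (fst u \<otimes>\<^bsub>D\<^esub> fst v,
       fst u \<odot>\<^bsub>N\<^esub> snd v \<oplus>\<^bsub>N\<^esub> fst v \<odot>\<^bsub>N\<^esub> snd u \<oplus>\<^bsub>N\<^esub> snd u \<otimes>\<^bsub>N\<^esub> snd v)),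
     one = (\<one>\<^bsub>D\<^esub>, \<zero>\<^bsub>N\<^esub>),
     ring.zero = (\<zero>\<^bsub>D\<^esub>, \<zero>\<^bsub>N\<^esub>),
     ring.add = (\<lambda>u v. (fst u \<oplus>\<^bsub>D\<^esub> fst v, snd u \<oplus>\<^bsub>N\<^esub> snd v))\<rparr>"

lemma unitization_simps:
  "carrier (unitization D N) = carrier D \<times> carrier N"
  "u \<otimes>\<^bsub>unitization D N\<^esub> v = (fst u \<otimes>\<^bsub>D\<^esub> fst v,
       fst u \<odot>\<^bsub>N\<^esub> snd v \<oplus>\<^bsub>N\<^esub> fst v \<odot>\<^bsub>N\<^esub> snd u \<oplus>\<^bsub>N\<^esub> snd u \<otimes>\<^bsub>N\<^esub> snd v)"
  "\<one>\<^bsub>unitization D N\<^esub> = (\<one>\<^bsub>D\<^esub>, \<zero>\<^bsub>N\<^esub>)"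
  "\<zero>\<^bsub>unitization D N\<^esub> = (\<zero>\<^bsub>D\<^esub>, \<zero>\<^bsub>N\<^esub>)"
  "u \<oplus>\<^bsub>unitization D N\<^esub> v = (fst u \<oplus>\<^bsub>D\<^esub> fst v, snd u \<oplus>\<^bsub>N\<^esub> snd v)"
  by (simp_all add: unitization_def)

locale commutative_module_ring = module D N + nonunital_cring N
  for D :: "('d, 'e) ring_scheme" (structure) and N :: "('d, 'n, 'm) module_scheme" (structure) +
  assumes smult_mult: "\<lbrakk>d \<in> carrier D; x \<in> carrier N; y \<in> carrier N\<rbrakk>
    \<Longrightarrow> d \<odot>\<^bsub>N\<^esub> (x \<otimes>\<^bsub>N\<^esub> y) = (d \<odot>\<^bsub>N\<^esub> x) \<otimes>\<^bsub>N\<^esub> y"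
begin

lemma mult_smult: "\<lbrakk>d \<in> carrier D; x \<in> carrier N; y \<in> carrier N\<rbrakk>
    \<Longrightarrow> x \<otimes>\<^bsub>N\<^esub> (d \<odot>\<^bsub>N\<^esub> y) = (d \<odot>\<^bsub>N\<^esub> x) \<otimes>\<^bsub>N\<^esub> y"
  by (metis nu_comm smult_closed smult_mult)

lemma abelian_group_unitization: "abelian_group (unitization D N)"
proof (rule abelian_groupI)
  fix u assume "u \<in> carrier (unitization D N)"
  then have "fst u \<in> carrier D" "snd u \<in> carrier N" by (auto simp: unitization_simps)
  then show "\<exists>v\<in>carrier (unitization D N). v \<oplus>\<^bsub>unitization D N\<^esub> u = \<zero>\<^bsub>unitization D N\<^esub>"
    by (intro bexI[of _ "(\<ominus>\<^bsub>D\<^esub> fst u, \<ominus>\<^bsub>N\<^esub> snd u)"])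
      (simp_all add: unitization_simps R.l_neg M.l_neg)
qed (auto simp: unitization_simps R.a_ac M.a_ac)

lemma cring_unitization: "cring (unitization D N)"
proof (rule cringI)
  let ?U = "unitization D N"
  show "abelian_group ?U" by (rule abelian_group_unitization)
  show "Group.comm_monoid ?U"
  proof (rule comm_monoidI)
    fix u v assume uv: "u \<in> carrier ?U" "v \<in> carrier ?U"
    then have c: "fst u \<in> carrier D" "snd u \<in> carrier N" "fst v \<in> carrier D" "snd v \<in> carrier N"
      by (auto simp: unitization_simps)
    then show "u \<otimes>\<^bsub>?U\<^esub> v \<in> carrier ?U" by (simp add: unitization_simps nu_closed)
    show "u \<otimes>\<^bsub>?U\<^esub> v = v \<otimes>\<^bsub>?U\<^esub> u"
      using c nu_comm[of "snd u" "snd v"]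
      by (simp add: unitization_simps nu_closed R.m_comm M.a_ac)
    fix w assume "w \<in> carrier ?U"
    then have d: "fst w \<in> carrier D" "snd w \<in> carrier N" by (auto simp: unitization_simps)
    show "u \<otimes>\<^bsub>?U\<^esub> v \<otimes>\<^bsub>?U\<^esub> w = u \<otimes>\<^bsub>?U\<^esub> (v \<otimes>\<^bsub>?U\<^esub> w)"
      using c d
      by (simp add: unitization_simps nu_closed nu_l_distr nu_r_distr smult_r_distr
          smult_assoc1[symmetric] smult_mult mult_smult nu_assoc R.m_ac M.a_ac)
  next
    fix u assume "u \<in> carrier ?U"
    then show "\<one>\<^bsub>?U\<^esub> \<otimes>\<^bsub>?U\<^esub> u = u" by (auto simp: unitization_simps nu_l_null)
  qed (simp add: unitization_simps)
  fix u v w assume "u \<in> carrier ?U" "v \<in> carrier ?U" "w \<in> carrier ?U"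
  then show "(u \<oplus>\<^bsub>?U\<^esub> v) \<otimes>\<^bsub>?U\<^esub> w = u \<otimes>\<^bsub>?U\<^esub> w \<oplus>\<^bsub>?U\<^esub> v \<otimes>\<^bsub>?U\<^esub> w"
    by (auto simp: unitization_simps nu_closed nu_l_distr smult_l_distr smult_r_distr R.l_distr M.a_ac)
qed

abbreviation embedded_ring :: "('d \<times> 'n) set" where
  "embedded_ring \<equiv> {\<zero>\<^bsub>D\<^esub>} \<times> carrier N"

lemma ideal_embedded_ring: "ideal embedded_ring (unitization D N)"
proof -
  interpret U: cring "unitization D N" by (rule cring_unitization)
  show ?thesis
  proof (rule idealI)
    show "ring (unitization D N)" by (rule U.ring_axioms)
    show "subgroup embedded_ring (add_monoid (unitization D N))"
    proof (rule U.add.subgroupI)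
      fix u assume "u \<in> embedded_ring"
      then obtain x where x: "x \<in> carrier N" "u = (\<zero>\<^bsub>D\<^esub>, x)" by auto
      have "\<ominus>\<^bsub>unitization D N\<^esub> u = (\<zero>\<^bsub>D\<^esub>, \<ominus>\<^bsub>N\<^esub> x)"
        using x by (intro U.minus_equality) (simp_all add: unitization_simps M.l_neg)
      then show "\<ominus>\<^bsub>unitization D N\<^esub> u \<in> embedded_ring" using x by simp
    qed (auto simp: unitization_simps)
  qed (auto simp: unitization_simps nu_closed)
qed

lemma scalar_hom: "ring_hom_cring D (unitization D N) (\<lambda>d. (d, \<zero>\<^bsub>N\<^esub>))"
  by (intro ring_hom_cringI[OF R.is_cring cring_unitization] ring_hom_memI)
    (simp_all add: unitization_simps nu_l_null)

lemma scalar_multiple_of_one: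
  "([n] \<cdot>\<^bsub>D\<^esub> \<one>\<^bsub>D\<^esub>, \<zero>\<^bsub>N\<^esub>) = [n] \<cdot>\<^bsub>unitization D N\<^esub> \<one>\<^bsub>unitization D N\<^esub>" for n :: nat
proof -
  let ?U = "unitization D N" and ?h = "\<lambda>d. (d, \<zero>\<^bsub>N\<^esub>)"
  interpret U: cring ?U by (rule cring_unitization)
  interpret h: ring_hom_cring D ?U ?h by (rule scalar_hom)
  show ?thesis
  proof (induction n)
    case 0
    show ?case by (simp only: R.add.nat_pow_0 h.hom_zero U.add.nat_pow_0)
  next
    case (Suc n)
    have "?h ([Suc n] \<cdot>\<^bsub>D\<^esub> \<one>\<^bsub>D\<^esub>) = ?h ([n] \<cdot>\<^bsub>D\<^esub> \<one>\<^bsub>D\<^esub>) \<oplus>\<^bsub>?U\<^esub> ?h \<one>\<^bsub>D\<^esub>"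
      unfolding R.add.nat_pow_Suc
      by (rule h.hom_add[OF R.add.nat_pow_closed[OF R.one_closed] R.one_closed])
    then show ?case by (simp only: Suc.IH h.hom_one U.add.nat_pow_Suc)
  qed
qed

lemma scalar_separated:
  fixes p :: nat
  assumes c: "s \<in> carrier D" "t \<in> carrier D"
    and sep: "\<exists>e\<in>carrier D. \<exists>v\<in>carrier D.
      e \<otimes>\<^bsub>D\<^esub> (s \<ominus>\<^bsub>D\<^esub> t) = \<one>\<^bsub>D\<^esub> \<oplus>\<^bsub>D\<^esub> ([p] \<cdot>\<^bsub>D\<^esub> \<one>\<^bsub>D\<^esub>) \<otimes>\<^bsub>D\<^esub> v"
  shows "\<exists>e\<in>carrier (unitization D N). \<exists>v\<in>carrier (unitization D N).
      e \<otimes>\<^bsub>unitization D N\<^esub> ((s, \<zero>\<^bsub>N\<^esub>) \<ominus>\<^bsub>unitization D N\<^esub> (t, \<zero>\<^bsub>N\<^esub>))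
        = \<one>\<^bsub>unitization D N\<^esub> \<oplus>\<^bsub>unitization D N\<^esub> ([p] \<cdot>\<^bsub>unitization D N\<^esub> \<one>\<^bsub>unitization D N\<^esub>) \<otimes>\<^bsub>unitization D N\<^esub> v"
proof -
  let ?U = "unitization D N" and ?h = "\<lambda>d. (d, \<zero>\<^bsub>N\<^esub>)"
  interpret U: cring ?U by (rule cring_unitization)
  interpret h: ring_hom_cring D ?U ?h by (rule scalar_hom)
  obtain e v where ev: "e \<in> carrier D" "v \<in> carrier D"
    "e \<otimes>\<^bsub>D\<^esub> (s \<ominus>\<^bsub>D\<^esub> t) = \<one>\<^bsub>D\<^esub> \<oplus>\<^bsub>D\<^esub> ([p] \<cdot>\<^bsub>D\<^esub> \<one>\<^bsub>D\<^esub>) \<otimes>\<^bsub>D\<^esub> v"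
    using sep by blast
  have P: "[p] \<cdot>\<^bsub>D\<^esub> \<one>\<^bsub>D\<^esub> \<in> carrier D" by simp
  have minus: "?h s \<ominus>\<^bsub>?U\<^esub> ?h t = ?h (s \<ominus>\<^bsub>D\<^esub> t)"
    unfolding a_minus_def using c by (simp only: h.hom_add h.hom_a_inv R.a_inv_closed)
  have "?h e \<otimes>\<^bsub>?U\<^esub> (?h s \<ominus>\<^bsub>?U\<^esub> ?h t) = ?h (e \<otimes>\<^bsub>D\<^esub> (s \<ominus>\<^bsub>D\<^esub> t))"
    unfolding minus using ev(1) c by (simp only: h.hom_mult R.minus_closed)
  also have "\<dots> = ?h \<one>\<^bsub>D\<^esub> \<oplus>\<^bsub>?U\<^esub> ?h ([p] \<cdot>\<^bsub>D\<^esub> \<one>\<^bsub>D\<^esub>) \<otimes>\<^bsub>?U\<^esub> ?h v"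
    unfolding ev(3) using ev(2) P by (simp only: h.hom_add h.hom_mult R.one_closed R.m_closed)
  also have "\<dots> = \<one>\<^bsub>?U\<^esub> \<oplus>\<^bsub>?U\<^esub> ([p] \<cdot>\<^bsub>?U\<^esub> \<one>\<^bsub>?U\<^esub>) \<otimes>\<^bsub>?U\<^esub> ?h v"
    by (simp only: scalar_multiple_of_one h.hom_one)
  finally show ?thesis using ev(1,2) h.hom_closed by blast
qed

text \<open>The inverse of \<open>1 + x\<close> in the unitization comes from the inverse of \<open>x\<close> in the adjoint group, as
  \<open>(1 + x) (1 + y) = 1 + (x + y + x y)\<close>.\<close>

lemma quasi_regular_ideal_unitization:
  assumes radical: "group (adjoint_group N)" and fin: "finite (carrier N)"
    and p: "Factorial_Ring.prime p" and T: "T \<subseteq> carrier D"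
    and sep: "\<And>s t. \<lbrakk>s \<in> T; t \<in> T; s \<noteq> t\<rbrakk> \<Longrightarrow>
      \<exists>e\<in>carrier D. \<exists>v\<in>carrier D. e \<otimes>\<^bsub>D\<^esub> (s \<ominus>\<^bsub>D\<^esub> t) = \<one>\<^bsub>D\<^esub> \<oplus>\<^bsub>D\<^esub> ([p] \<cdot>\<^bsub>D\<^esub> \<one>\<^bsub>D\<^esub>) \<otimes>\<^bsub>D\<^esub> v"
  shows "quasi_regular_ideal embedded_ring (unitization D N) p ((\<lambda>d. (d, \<zero>\<^bsub>N\<^esub>)) ` T)"
proof -
  let ?U = "unitization D N" and ?h = "\<lambda>d. (d, \<zero>\<^bsub>N\<^esub>)"
  interpret U: cring ?U by (rule cring_unitization)
  show ?thesis
  proof (intro quasi_regular_ideal.intro quasi_regular_ideal_axioms.intro)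
    show "cring ?U" by (rule cring_unitization)
    show "ideal embedded_ring ?U" by (rule ideal_embedded_ring)
    show "finite embedded_ring" using fin by simp
    show "Factorial_Ring.prime p" by (rule p)
    show "?h ` T \<subseteq> carrier ?U" using T by (auto simp: unitization_simps)
  next
    fix u assume "u \<in> embedded_ring"
    then obtain x where x: "x \<in> carrier N" "u = (\<zero>\<^bsub>D\<^esub>, x)" by auto
    then obtain y where y: "y \<in> carrier N" "x \<oplus>\<^bsub>N\<^esub> y \<oplus>\<^bsub>N\<^esub> x \<otimes>\<^bsub>N\<^esub> y = \<zero>\<^bsub>N\<^esub>"
      using group.r_inv_ex[OF radical, of x] by (auto simp: adjoint_group_def)
    have "(\<one>\<^bsub>?U\<^esub> \<oplus>\<^bsub>?U\<^esub> u) \<otimes>\<^bsub>?U\<^esub> (\<one>\<^bsub>?U\<^esub> \<oplus>\<^bsub>?U\<^esub> (\<zero>\<^bsub>D\<^esub>, y)) = (\<one>\<^bsub>D\<^esub>, x \<oplus>\<^bsub>N\<^esub> y \<oplus>\<^bsub>N\<^esub> x \<otimes>\<^bsub>N\<^esub> y)"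
      using x y(1) nu_closed by (simp add: unitization_simps M.a_ac)
    also have "\<dots> = \<one>\<^bsub>?U\<^esub>" by (simp add: y(2) unitization_simps)
    finally show "\<exists>v\<in>embedded_ring. (\<one>\<^bsub>?U\<^esub> \<oplus>\<^bsub>?U\<^esub> u) \<otimes>\<^bsub>?U\<^esub> (\<one>\<^bsub>?U\<^esub> \<oplus>\<^bsub>?U\<^esub> v) = \<one>\<^bsub>?U\<^esub>"
      using y(1) by auto
  next
    fix s' t' assume "s' \<in> ?h ` T" "t' \<in> ?h ` T" "s' \<noteq> t'"
    then obtain s t where st: "s \<in> T" "t \<in> T" "s \<noteq> t" "s' = ?h s" "t' = ?h t" by blast
    show "\<exists>e\<in>carrier ?U. \<exists>v\<in>carrier ?U. e \<otimes>\<^bsub>?U\<^esub> (s' \<ominus>\<^bsub>?U\<^esub> t') = \<one>\<^bsub>?U\<^esub> \<oplus>\<^bsub>?U\<^esub> ([p] \<cdot>\<^bsub>?U\<^esub> \<one>\<^bsub>?U\<^esub>) \<otimes>\<^bsub>?U\<^esub> v"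
      unfolding st(4,5) using st(1,2) T by (intro scalar_separated sep st(1-3)) auto
  qed
qed

lemma embed_iso:
  assumes "carrier G = carrier N" "carrier H = embedded_ring"
    and "\<And>x y. \<lbrakk>x \<in> carrier N; y \<in> carrier N\<rbrakk> \<Longrightarrow> (\<zero>\<^bsub>D\<^esub>, x \<otimes>\<^bsub>G\<^esub> y) = (\<zero>\<^bsub>D\<^esub>, x) \<otimes>\<^bsub>H\<^esub> (\<zero>\<^bsub>D\<^esub>, y)"
  shows "G \<cong> H"
proof -
  have "Pair \<zero>\<^bsub>D\<^esub> \<in> iso G H"
    using assms by (intro isoI homI) (auto simp: bij_betw_def inj_on_def)
  then show ?thesis by (auto simp: is_iso_def)
qed

end

theorem theorem3p5:
  fixes D :: "('d, 'e) ring_scheme" and N :: "('d, 'n, 'm) module_scheme" and p lam :: nat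
  assumes "principal_domain D"
    and "Factorial_Ring.prime p"
    and "primeideal (nat_ideal D p) D"
    and "finite (carrier (D Quot (nat_ideal D p)))"
    and "lam = residue_degree D p"
    and "nonunital_cring N"
    and "radical_ring N"
    and "\<exists>n. order N = p ^ n"
    and "module_ring D N"
    and "small_group lam p (add_monoid N) \<or> small_group lam p (adjoint_group N)"
  shows "add_monoid N \<cong> adjoint_group N"
proof -
  obtain n where n: "order N = p ^ n" using assms(8) by blast
  have fin: "finite (carrier N)"
    using n prime_gt_0_nat[OF assms(2)] by (intro card_ge_0_finite) (simp add: order_def)
  have adj: "group (adjoint_group N)" using assms(7) by (simp add: radical_ring_iff_adjoint_group)
  interpret commutative_module_ring D N
    using assms(6,9)
    by (simp add: commutative_module_ring_def commutative_module_ring_axioms_def module_ring_def)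
  obtain T where T: "T \<subseteq> carrier D" "card T = p ^ lam"
    and sep: "\<And>s t. \<lbrakk>s \<in> T; t \<in> T; s \<noteq> t\<rbrakk> \<Longrightarrow>
      \<exists>e\<in>carrier D. \<exists>v\<in>carrier D. e \<otimes>\<^bsub>D\<^esub> (s \<ominus>\<^bsub>D\<^esub> t) = \<one>\<^bsub>D\<^esub> \<oplus>\<^bsub>D\<^esub> ([p] \<cdot>\<^bsub>D\<^esub> \<one>\<^bsub>D\<^esub>) \<otimes>\<^bsub>D\<^esub> v"
    using R.residue_system_exists[OF assms(2-4)] unfolding assms(5)[symmetric] by blast
  interpret Q: quasi_regular_ideal embedded_ring "unitization D N" p "(\<lambda>d. (d, \<zero>\<^bsub>N\<^esub>)) ` T"
    by (rule quasi_regular_ideal_unitization[OF adj fin assms(2) T(1) sep])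
  have gA: "group (add_monoid N)" by (rule M.a_group)
  have gA': "group (Q.add_group embedded_ring)" and gU': "group Q.adj"
    using Q.comm_group_add_group[OF Q.ideal_axioms] Q.comm_group_adj by (auto dest: comm_group.axioms)
  have isoA: "add_monoid N \<cong> Q.add_group embedded_ring"
    by (rule embed_iso) (auto simp: Q.add_group_def unitization_simps)
  have isoU: "adjoint_group N \<cong> Q.adj"
    by (rule embed_iso)
      (auto simp: Q.adj_carrier Q.adj_mult adjoint_group_def unitization_simps nu_closed)
  have "Q.add_group embedded_ring \<cong> Q.adj"
  proof (rule Q.add_group_iso_adj)
    show "card ((\<lambda>d. (d, \<zero>\<^bsub>N\<^esub>)) ` T) = p ^ lam"
      using T(2) by (subst card_image) (auto simp: inj_on_def)
    show "card embedded_ring = p ^ n" using n by (simp add: order_def card_cartesian_product_singleton)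
    show "small_group lam p (Q.add_group embedded_ring) \<or> small_group lam p Q.adj"
      using assms(10) small_group_iso[OF gA gA' isoA] small_group_iso[OF adj gU' isoU] by simp
  qed
  with isoA have "add_monoid N \<cong> Q.adj" by (rule iso_trans)
  also have "\<dots> \<cong> adjoint_group N" by (rule group.iso_sym[OF adj isoU])
  finally show ?thesis .
qed

end
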